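(* (Abstract countable admissible filters $\Theta\subseteq\mathcal{P}(\mathbb{P})$ are dual to concrete countable complete locally uniform compatible filters $\Theta\subseteq\mathcal{C}_X(\mathbb{P})$ where $\mathbb{P}\subseteq\mathcal{O}(X)$ is a basis of a completely metrisable space $X$.) Precisely: (1) Let $(\mathbb{P},\leq)$ be a poset and let $\Theta\subseteq\mathcal{P}(\mathbb{P})$ be a countable admissible filter. Put $U_p=\{R\in\widehat{\Theta^{\mathsf{R}}}:p\in R\}$ for $p\in\mathbb{P}$. Then $\widehat{\Theta^{\mathsf{R}}}$ is completely metrisable, $\{U_p:p\in\mathbb{P}\}$ is a basis of $\widehat{\Theta^{\mathsf{R}}}$, $p\leq q\Leftrightarrow U_p\subseteq U_q$ for all $p,q\in\mathbb{P}$, and $\{\{U_c:c\in C\}:C\in\Theta\}$ is a countable filter of covers of $\widehat{\Theta^{\mathsf{R}}}$ by elements of $\{U_p:p\in\mathbb{P}\}$ that is complete, locally uniform and compatible with the topology of $\widehat{\Theta^{\mathsf{R}}}$. (2) Conversely, let $X$ be a completely metrisable space, let $\mathbb{P}\subseteq\mathcal{O}(X)$ be a basis of $X$ ordered by $\leq\ =\ \subseteq$, and let $\Theta\subseteq\mathcal{C}_X(\mathbb{P})$ be a countable complete locally uniform filter that is compatible with the topology of $X$. Then $\Theta$ is admissible, $$\widehat{\Theta^{\mathsf{R}}}=\{R\subseteq\dot{\mathbb{P}}:R\text{ is a }\Theta\text{-Cauchy }\vartriangleleft\text{-filter}\}=\{\mathbb{P}_x:x\in X\},$$ and $\widehat{\Theta^{\mathsf{R}}}$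 is homeomorphic to $X$.
   Context: $\mathcal{O}(X)$ is the family of open sets of $X$; $\mathcal{C}_X(\mathbb{P})=\{C\subseteq\mathbb{P}:X\subseteq\bigcup C\}$; $\mathbb{P}_x=\{N\in\mathbb{P}:x\in N\}$. For a poset $(\mathbb{P},\leq)$, $\Phi\subseteq\mathcal{P}(\mathbb{P})$ (power set) and $R,S\subseteq\mathbb{P}$: $R\leq S$ ($R$ refines $S$) means $\forall r\in R\ \exists s\in S\ (r\leq s)$; $R\leq q$ means $r\leq q$ for all $r\in R$; $\Phi^\leq=\{D\subseteq\mathbb{P}:\exists C\in\Phi\ (C\leq D)\}$. $\Phi$ is an up-set if $\Phi^\leq\subseteq\Phi$; directed if for every finite (possibly empty) $\mathcal{G}\subseteq\Phi$ there is $C\in\Phi$ with $C\leq D$ for all $D\in\mathcal{G}$ (so $\Phi\neq\emptyset$); a filter if it is a directed up-set. (Families of subsets of a space are ordered by $\leq\ =\ \subseteq$.) Spectrum: $R\subseteq\mathbb{P}$ is $\Phi$-Cauchy if $C\cap R\neq\emptyset$ for all $C\in\Phi$; $\Phi$-round if for every $r\in R$ there is $C\in\Phi$ with $c\leq r$ for all $c\in C\cap R$. $\widehat\Phi$ is the set of all $\Phi$-round $\Phi$-Cauchy ($\leq$-)up-sets $R\subseteq\mathbb{P}$, with the topology having subbasis $(\{R\in\widehat\Phi:p\in R\})_{p\in\mathbb{P}}$. $S\subseteq\mathbb{P}$ is $\Theta^\leq$-near if there is $D\subseteq\mathbb{P}$ with $D\notin\Theta^\leq$ and $D\cup\{s\}\in\Theta^\leq$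 for all $s\in S$. $\dot{\mathbb{P}}=\{p\in\mathbb{P}:\{p\}\text{ is }\Theta^\leq\text{-near}\}$. For $C\subseteq\mathbb{P}$, $p\in\mathbb{P}$: $Cp=\{c\in C:\{c,p\}\text{ is }\Theta^\leq\text{-near}\}$. Uniformly below: $p\vartriangleleft q$ (or $p\vartriangleleft_\Theta q$) iff there is $C\in\Theta$ with $Cp\leq q$. $\Theta$ is admissible if for every $p\in\mathbb{P}$ the supremum of $\{q\in\mathbb{P}:q\vartriangleleft p\}$ exists and equals $p$. $R\subseteq\mathbb{P}$ is a $\vartriangleleft$-filter if $R$ is closed upwards under $\vartriangleleft$ ($r\in R$, $r\vartriangleleft p$ imply $p\in R$) and every finite (possibly empty) $F\subseteq R$ has some $s\in R$ with $s\vartriangleleft f$ for all $f\in F$. Regularisation: for $C\subseteq\mathbb{P}$ put $C^\vartriangleright=\{p\in\mathbb{P}:\exists c\in C\ (p\vartriangleleft_\Theta c)\}$. Let $\Theta^1=\Theta$, $\Theta^{n+1}=\{C^\vartriangleright:C\in\Theta^n\}$, and $\Theta^{\mathsf{R}}=\bigcup_{n\geq1}\Theta^n$. For a space $X$ and $\Theta\subseteq\mathcal{P}(\mathcal{P}(X))$: for $C\in\Theta$ and $x\in X$, $C_x=\{c\in C:x\in c\}$, and for $p\subseteq X$, $C*p=\{c\in C:c\cap p\neq\emptyset\}$. $\Theta$ is compatible with the topology of $X$ if for every $x\in X$ the family $(\bigcup C_x)_{C\in\Theta}$ is a neighbourhood base at $x$ (a family of not necessarily open neighbourhoods of $x$,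 with every neighbourhood of $x$ containing one of them). $\Theta$ is locally uniform if for all $x\in X$ and $C\in\Theta$ there is $D\in\Theta$ with $\bigcup(D*\bigcup D_x)\subseteq\bigcup C_x$. A filter $\Theta\subseteq\mathcal{C}_X(\mathbb{P})$ (with $\mathbb{P}\subseteq\mathcal{O}(X)$ ordered by $\subseteq$) is complete if for every $\Theta$-Cauchy $\vartriangleleft$-filter $R\subseteq\mathbb{P}$ there is $x\in X$ with $\mathbb{P}_x\subseteq R$. *)

theory Defs
  imports "HOL-Analysis.Analysis"
begin

(* A poset is a carrier set P together with a relation le; only the restriction of le to P
   matters.  Families of sets are ordered by taking le to be (\<subseteq>). *)

definition poset :: "'a set \<Rightarrow> ('a \<Rightarrow> 'a \<Rightarrow> bool) \<Rightarrow> bool" where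
  "poset P le \<longleftrightarrow> reflp_on P le \<and> antisymp_on P le \<and> transp_on P le"

definition is_supremum :: "'a set \<Rightarrow> ('a \<Rightarrow> 'a \<Rightarrow> bool) \<Rightarrow> 'a set \<Rightarrow> 'a \<Rightarrow> bool" where
  "is_supremum P le A s \<longleftrightarrow>
     s \<in> P \<and> (\<forall>a\<in>A. le a s) \<and> (\<forall>u\<in>P. (\<forall>a\<in>A. le a u) \<longrightarrow> le s u)"

definition refines :: "('a \<Rightarrow> 'a \<Rightarrow> bool) \<Rightarrow> 'a set \<Rightarrow> 'a set \<Rightarrow> bool" where
  "refines le R S \<longleftrightarrow> (\<forall>r\<in>R. \<exists>s\<in>S. le r s)"

definition refinement_closure :: "'a set \<Rightarrow> ('a \<Rightarrow> 'a \<Rightarrow> bool) \<Rightarrow> 'a set set \<Rightarrow> 'a set set" where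
  "refinement_closure P le \<Phi> = {D. D \<subseteq> P \<and> (\<exists>C\<in>\<Phi>. refines le C D)}"

definition refinement_directed :: "('a \<Rightarrow> 'a \<Rightarrow> bool) \<Rightarrow> 'a set set \<Rightarrow> bool" where
  "refinement_directed le \<Phi> \<longleftrightarrow>
     (\<forall>\<G>. finite \<G> \<and> \<G> \<subseteq> \<Phi> \<longrightarrow> (\<exists>C\<in>\<Phi>. \<forall>D\<in>\<G>. refines le C D))"

definition refinement_filter :: "'a set \<Rightarrow> ('a \<Rightarrow> 'a \<Rightarrow> bool) \<Rightarrow> 'a set set \<Rightarrow> bool" where
  "refinement_filter P le \<Phi> \<longleftrightarrow>
     \<Phi> \<subseteq> Pow P \<and> refinement_directed le \<Phi> \<and> refinement_closure P le \<Phi> \<subseteq> \<Phi>"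

(* "Countable" for a filter means countable up to generating it, as for uniformities: it has a
   countable base.  A filter contains all supersets (within P) of its members, so asking the
   filter itself to be a countable set would force every member to have finite complement in P.
   Filters that are countable as sets are covered, being their own base. *)
definition countable_filter :: "'a set \<Rightarrow> ('a \<Rightarrow> 'a \<Rightarrow> bool) \<Rightarrow> 'a set set \<Rightarrow> bool" where
  "countable_filter P le \<Phi> \<longleftrightarrow>
     refinement_filter P le \<Phi> \<and>
     (\<exists>\<Psi>\<subseteq>\<Phi>. countable \<Psi> \<and> (\<forall>C\<in>\<Phi>. \<exists>B\<in>\<Psi>. refines le B C))"

lemma countable_filterI:
  assumes "poset P le" and filt: "refinement_filter P le \<Phi>" and cnt: "countable \<Phi>"
  shows "countable_filter P le \<Phi>"
proof -
  have "refines le C C" if "C \<in> \<Phi>" for C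
    using assms that unfolding refines_def refinement_filter_def poset_def
    by (blast dest: reflp_onD)
  then show ?thesis
    using filt cnt unfolding countable_filter_def by blast
qed

definition set_cauchy :: "'a set set \<Rightarrow> 'a set \<Rightarrow> bool" where
  "set_cauchy \<Phi> R \<longleftrightarrow> (\<forall>C\<in>\<Phi>. C \<inter> R \<noteq> {})"

definition set_round :: "('a \<Rightarrow> 'a \<Rightarrow> bool) \<Rightarrow> 'a set set \<Rightarrow> 'a set \<Rightarrow> bool" where
  "set_round le \<Phi> R \<longleftrightarrow> (\<forall>r\<in>R. \<exists>C\<in>\<Phi>. \<forall>c\<in>C \<inter> R. le c r)"

definition up_set :: "'a set \<Rightarrow> ('a \<Rightarrow> 'a \<Rightarrow> bool) \<Rightarrow> 'a set \<Rightarrow> bool" where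
  "up_set P le R \<longleftrightarrow> R \<subseteq> P \<and> (\<forall>r\<in>R. \<forall>p\<in>P. le r p \<longrightarrow> p \<in> R)"

definition spectrum :: "'a set \<Rightarrow> ('a \<Rightarrow> 'a \<Rightarrow> bool) \<Rightarrow> 'a set set \<Rightarrow> 'a set set" where
  "spectrum P le \<Phi> = {R. up_set P le R \<and> set_cauchy \<Phi> R \<and> set_round le \<Phi> R}"

definition spectrum_open ::
  "'a set \<Rightarrow> ('a \<Rightarrow> 'a \<Rightarrow> bool) \<Rightarrow> 'a set set \<Rightarrow> 'a \<Rightarrow> 'a set set" where
  "spectrum_open P le \<Phi> p = {R \<in> spectrum P le \<Phi>. p \<in> R}"

(* The whole spectrum is inserted because topology_generated_by does not count the empty
   intersection of subbasic sets. *)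
definition spectrum_topology ::
  "'a set \<Rightarrow> ('a \<Rightarrow> 'a \<Rightarrow> bool) \<Rightarrow> 'a set set \<Rightarrow> 'a set topology" where
  "spectrum_topology P le \<Phi> =
     topology_generated_by (insert (spectrum P le \<Phi>) (spectrum_open P le \<Phi> ` P))"

lemma topspace_spectrum_topology [simp]:
  "topspace (spectrum_topology P le \<Phi>) = spectrum P le \<Phi>"
  unfolding spectrum_topology_def spectrum_open_def topology_generated_by_topspace by auto

definition near :: "'a set \<Rightarrow> ('a \<Rightarrow> 'a \<Rightarrow> bool) \<Rightarrow> 'a set set \<Rightarrow> 'a set \<Rightarrow> bool" where
  "near P le \<Theta> S \<longleftrightarrow>
     S \<subseteq> P \<and>
     (\<exists>D\<subseteq>P. D \<notin> refinement_closure P le \<Theta> \<and>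
        (\<forall>s\<in>S. D \<union> {s} \<in> refinement_closure P le \<Theta>))"

definition near_elements :: "'a set \<Rightarrow> ('a \<Rightarrow> 'a \<Rightarrow> bool) \<Rightarrow> 'a set set \<Rightarrow> 'a set" where
  "near_elements P le \<Theta> = {p \<in> P. near P le \<Theta> {p}}"

definition near_star ::
  "'a set \<Rightarrow> ('a \<Rightarrow> 'a \<Rightarrow> bool) \<Rightarrow> 'a set set \<Rightarrow> 'a set \<Rightarrow> 'a \<Rightarrow> 'a set" where
  "near_star P le \<Theta> C p = {c \<in> C. near P le \<Theta> {c, p}}"

definition unif_below ::
  "'a set \<Rightarrow> ('a \<Rightarrow> 'a \<Rightarrow> bool) \<Rightarrow> 'a set set \<Rightarrow> 'a \<Rightarrow> 'a \<Rightarrow> bool" where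
  "unif_below P le \<Theta> p q \<longleftrightarrow>
     p \<in> P \<and> q \<in> P \<and> (\<exists>C\<in>\<Theta>. \<forall>c\<in>near_star P le \<Theta> C p. le c q)"

definition admissible :: "'a set \<Rightarrow> ('a \<Rightarrow> 'a \<Rightarrow> bool) \<Rightarrow> 'a set set \<Rightarrow> bool" where
  "admissible P le \<Theta> \<longleftrightarrow>
     (\<forall>p\<in>P. is_supremum P le {q \<in> P. unif_below P le \<Theta> q p} p)"

definition unif_below_filter ::
  "'a set \<Rightarrow> ('a \<Rightarrow> 'a \<Rightarrow> bool) \<Rightarrow> 'a set set \<Rightarrow> 'a set \<Rightarrow> bool" where
  "unif_below_filter P le \<Theta> R \<longleftrightarrow>
     R \<subseteq> P \<and>
     (\<forall>r\<in>R. \<forall>p\<in>P. unif_below P le \<Theta> r p \<longrightarrow> p \<in> R) \<and>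
     (\<forall>F. finite F \<and> F \<subseteq> R \<longrightarrow> (\<exists>s\<in>R. \<forall>f\<in>F. unif_below P le \<Theta> s f))"

definition unif_shrink ::
  "'a set \<Rightarrow> ('a \<Rightarrow> 'a \<Rightarrow> bool) \<Rightarrow> 'a set set \<Rightarrow> 'a set \<Rightarrow> 'a set" where
  "unif_shrink P le \<Theta> C = {p \<in> P. \<exists>c\<in>C. unif_below P le \<Theta> p c}"

(* Every step shrinks with respect to the relation defined from the original family \<Theta>;
   the indexing starts at 0 instead of 1. *)
primrec regularisation_step ::
  "'a set \<Rightarrow> ('a \<Rightarrow> 'a \<Rightarrow> bool) \<Rightarrow> 'a set set \<Rightarrow> nat \<Rightarrow> 'a set set" where
  "regularisation_step P le \<Theta> 0 = \<Theta>"
| "regularisation_step P le \<Theta> (Suc n) = unif_shrink P le \<Theta> ` regularisation_step P le \<Theta> n"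

definition regularisation ::
  "'a set \<Rightarrow> ('a \<Rightarrow> 'a \<Rightarrow> bool) \<Rightarrow> 'a set set \<Rightarrow> 'a set set" where
  "regularisation P le \<Theta> = (\<Union>n. regularisation_step P le \<Theta> n)"

definition is_basis_of :: "'b topology \<Rightarrow> 'b set set \<Rightarrow> bool" where
  "is_basis_of X B \<longleftrightarrow>
     (\<forall>b\<in>B. openin X b) \<and> (\<forall>U. openin X U \<longrightarrow> (\<exists>B'\<subseteq>B. \<Union>B' = U))"

definition covers_of :: "'b topology \<Rightarrow> 'b set set \<Rightarrow> 'b set set set" where
  "covers_of X P = {C. C \<subseteq> P \<and> topspace X \<subseteq> \<Union>C}"

definition members_at :: "'b set set \<Rightarrow> 'b \<Rightarrow> 'b set set" where
  "members_at C x = {c \<in> C. x \<in> c}"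

definition members_meeting :: "'b set set \<Rightarrow> 'b set \<Rightarrow> 'b set set" where
  "members_meeting C p = {c \<in> C. c \<inter> p \<noteq> {}}"

definition nbhd_of :: "'b topology \<Rightarrow> 'b \<Rightarrow> 'b set \<Rightarrow> bool" where
  "nbhd_of X x N \<longleftrightarrow> N \<subseteq> topspace X \<and> (\<exists>U. openin X U \<and> x \<in> U \<and> U \<subseteq> N)"

definition compatible_family :: "'b topology \<Rightarrow> 'b set set set \<Rightarrow> bool" where
  "compatible_family X \<Theta> \<longleftrightarrow>
     (\<forall>x\<in>topspace X.
        (\<forall>C\<in>\<Theta>. nbhd_of X x (\<Union>(members_at C x))) \<and>
        (\<forall>N. nbhd_of X x N \<longrightarrow> (\<exists>C\<in>\<Theta>. \<Union>(members_at C x) \<subseteq> N)))"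

definition locally_uniform :: "'b topology \<Rightarrow> 'b set set set \<Rightarrow> bool" where
  "locally_uniform X \<Theta> \<longleftrightarrow>
     (\<forall>x\<in>topspace X. \<forall>C\<in>\<Theta>. \<exists>D\<in>\<Theta>.
        \<Union>(members_meeting D (\<Union>(members_at D x))) \<subseteq> \<Union>(members_at C x))"

definition complete_family :: "'b topology \<Rightarrow> 'b set set \<Rightarrow> 'b set set set \<Rightarrow> bool" where
  "complete_family X P \<Theta> \<longleftrightarrow>
     (\<forall>R\<subseteq>P. set_cauchy \<Theta> R \<and> unif_below_filter P (\<subseteq>) \<Theta> R \<longrightarrow>
        (\<exists>x\<in>topspace X. members_at P x \<subseteq> R))"

end

theory Submission
  imports Defs
begin

text \<open>Both halves rest on two descriptions of the points of the spectrum.  By definition, they are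
  the round Cauchy up-sets for the regularisation \<open>\<Theta>\<^sup>R\<close>.  Lemma \<open>spectrum_eq\<close> shows that for
  an admissible filter they are also the \<open>\<Theta>\<close>-Cauchy \<open>\<lhd>\<close>-filters of near elements, in terms of
  \<open>\<Theta>\<close> alone.  For round Cauchy up-sets, the shrunk families in \<open>\<Theta>\<^sup>R\<close> supply the elements
  uniformly below a given one; conversely, if \<open>C\<close> witnesses \<open>s \<lhd> r\<close> then each member of \<open>C\<close> in
  the filter touches \<open>s\<close>, so it is below \<open>r\<close>.

  From the poset to the space: if \<open>p\<close> is not below \<open>q\<close>, then admissibility and a countable base
  allow a \<open>\<lhd>\<close>-decreasing sequence to be built from \<open>p\<close> that enters a member of each family and
  never falls below \<open>q\<close>.  It generates a point that contains \<open>p\<close> but not \<open>q\<close>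
  (\<open>spectrum_separates\<close>), so \<open>p \<mapsto> U\<^sub>p\<close> is an order isomorphism onto a basis, and all notions
  that are defined from the order and \<open>\<Theta>\<close> are transported along it.  Covering, compatibility,
  local uniformity and completeness of the transported filter are then read off the description
  of points as \<open>\<lhd>\<close>-filters.

  Complete metrisability is proved for every $T_0$ space with a countable complete locally uniform
  compatible filter of covers.  Stars \<open>V n x\<close> of a decreasing base satisfy only a local axiom of
  the triangle, in which the radius depends on the point.  Following Frink, one absorbs this
  dependence into the choice of the radius: with \<open>W k x = V (f x k) x\<close> and \<open>f x (k + 1)\<close> large
  enough in terms of \<open>x\<close> and \<open>f x k\<close>, two meeting balls of size \<open>k + 1\<close> have their union in a ball
  of size \<open>k\<close> (\<open>ex_ball_system\<close>).  This is a uniformity with a countable base, and infima over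
  chains give a metric (\<open>metric_from_entourages\<close>).  If the radii are also chosen such that balls
  lie uniformly inside small basic sets, then the basic sets that contain a ball of fixed size
  around all late terms of a metric Cauchy sequence form a Cauchy \<open>\<lhd>\<close>-filter, and completeness of
  \<open>\<Theta>\<close> provides the limit (\<open>cauchy_converges\<close>).

  From the space to the poset: in a space, two basic sets are near if and only if they meet, so
  \<open>q \<lhd> p\<close> says that some cover in \<open>\<Theta>\<close> has its star around \<open>q\<close> inside \<open>p\<close>.  Local uniformity
  provides such \<open>q\<close> around each point of \<open>p\<close>, which is admissibility, and it makes each \<open>P\<^sub>x\<close> a
  \<open>\<lhd>\<close>-filter; completeness says that there are no others among the near Cauchy ones
  (\<open>cauchy_filters_eq_points\<close>).\<close>

section \<open>Bases of topologies\<close>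

lemma is_basis_ofI:
  assumes "\<And>b. b \<in> B \<Longrightarrow> openin X b"
    and "\<And>U x. openin X U \<Longrightarrow> x \<in> U \<Longrightarrow> \<exists>b\<in>B. x \<in> b \<and> b \<subseteq> U"
  shows "is_basis_of X B"
  unfolding is_basis_of_def
proof (intro conjI ballI allI impI)
  fix U assume "openin X U"
  then have "\<Union>{b \<in> B. b \<subseteq> U} = U"
    using assms(2) by blast
  then show "\<exists>B'\<subseteq>B. \<Union>B' = U"
    by (intro exI[of _ "{b \<in> B. b \<subseteq> U}"]) auto
qed (use assms(1) in auto)

lemma is_basis_of_openin: "is_basis_of X B \<Longrightarrow> b \<in> B \<Longrightarrow> openin X b"
  unfolding is_basis_of_def by blast

lemma is_basis_ofE:
  assumes "is_basis_of X B" "openin X U" "x \<in> U"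
  obtains b where "b \<in> B" "x \<in> b" "b \<subseteq> U"
proof -
  obtain B' where "B' \<subseteq> B" "\<Union>B' = U"
    using assms unfolding is_basis_of_def by blast
  then show ?thesis
    using that assms(3) by blast
qed

lemma openin_iff_basis:
  assumes "is_basis_of X B"
  shows "openin X U \<longleftrightarrow> (\<forall>x\<in>U. \<exists>b\<in>B. x \<in> b \<and> b \<subseteq> U)"
proof
  assume U: "openin X U"
  show "\<forall>x\<in>U. \<exists>b\<in>B. x \<in> b \<and> b \<subseteq> U"
  proof
    fix x assume "x \<in> U"
    then obtain b where "b \<in> B" "x \<in> b" "b \<subseteq> U"
      by (rule is_basis_ofE[OF assms U])
    then show "\<exists>b\<in>B. x \<in> b \<and> b \<subseteq> U"
      by blast
  qed
next
  assume "\<forall>x\<in>U. \<exists>b\<in>B. x \<in> b \<and> b \<subseteq> U"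
  then show "openin X U"
    unfolding openin_subopen[of X U] using is_basis_of_openin[OF assms] by blast
qed

lemma t0_space_basis_eq:
  assumes "t0_space X" "is_basis_of X B" "x \<in> topspace X" "y \<in> topspace X"
    and "\<And>b. b \<in> B \<Longrightarrow> x \<in> b \<longleftrightarrow> y \<in> b"
  shows "x = y"
proof (rule ccontr)
  assume "x \<noteq> y"
  then obtain U where "openin X U" "x \<notin> U \<longleftrightarrow> y \<in> U"
    using assms(1,3,4) unfolding t0_space_def by blast
  then show False
    using openin_iff_basis[OF assms(2)] assms(5) by blast
qed

section \<open>Refinement filters\<close>

lemma refines_trans:
  assumes "poset P le" "A \<subseteq> P" "B \<subseteq> P" "C \<subseteq> P" "refines le A B" "refines le B C"
  shows "refines le A C"
  unfolding refines_def
proof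
  fix a assume a: "a \<in> A"
  then obtain b where b: "b \<in> B" "le a b"
    using assms(5) unfolding refines_def by blast
  then obtain c where c: "c \<in> C" "le b c"
    using assms(6) unfolding refines_def by blast
  have "le a c"
    using assms(1-4) a b c unfolding poset_def by (blast dest: transp_onD)
  then show "\<exists>c\<in>C. le a c"
    using c by blast
qed

text \<open>Taking common refinements one after the other turns a countable base into a decreasing
  sequence.\<close>

lemma countable_filter_sequence:
  assumes P: "poset P le" and cf: "countable_filter P le \<Theta>"
  shows "\<exists>B :: nat \<Rightarrow> 'a set. (\<forall>n. B n \<in> \<Theta>) \<and> (\<forall>n. refines le (B (Suc n)) (B n)) \<and>
    (\<forall>C\<in>\<Theta>. \<exists>n. refines le (B n) C)"
proof -
  have sub: "\<Theta> \<subseteq> Pow P" and dir: "refinement_directed le \<Theta>"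
    using cf unfolding countable_filter_def refinement_filter_def by auto
  obtain \<Psi> where \<Psi>: "\<Psi> \<subseteq> \<Theta>" "countable \<Psi>" "\<forall>C\<in>\<Theta>. \<exists>A\<in>\<Psi>. refines le A C"
    using cf unfolding countable_filter_def by blast
  have "\<exists>C\<in>\<Theta>. \<forall>D\<in>{}. refines le C D"
    using dir unfolding refinement_directed_def by blast
  then have "\<Psi> \<noteq> {}"
    using \<Psi>(3) by blast
  define A where "A = from_nat_into \<Psi>"
  have A: "A n \<in> \<Theta>" for n
    using from_nat_into[OF \<open>\<Psi> \<noteq> {}\<close>] \<Psi>(1) unfolding A_def by blast
  have base: "\<exists>n. refines le (A n) C" if "C \<in> \<Theta>" for C
    using \<Psi>(2,3) that unfolding A_def by (metis from_nat_into_surj)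
  have "\<exists>E. E \<in> \<Theta> \<and> (refines le E C \<and> refines le E (A n))" if "C \<in> \<Theta>" for C n
  proof -
    have "finite {C, A n} \<and> {C, A n} \<subseteq> \<Theta>"
      using that A by simp
    then have "\<exists>E\<in>\<Theta>. \<forall>D\<in>{C, A n}. refines le E D"
      using dir unfolding refinement_directed_def by blast
    then show ?thesis
      by auto
  qed
  then obtain B where B: "\<And>n. B n \<in> \<Theta>"
    "\<And>n. refines le (B (Suc n)) (B n) \<and> refines le (B (Suc n)) (A n)"
    using A dependent_nat_choice[of "\<lambda>_ C. C \<in> \<Theta>" "\<lambda>n C E. refines le E C \<and> refines le E (A n)"]
    by blast
  have "\<exists>n. refines le (B n) C" if C: "C \<in> \<Theta>" for C
  proof -
    obtain n where "refines le (A n) C"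
      using base[OF C] by blast
    then have "refines le (B (Suc n)) C"
      using refines_trans[OF P _ _ _ B(2)[THEN conjunct2]] B(1) A C sub by blast
    then show ?thesis ..
  qed
  then show ?thesis
    using B by blast
qed

locale refinement_poset =
  fixes P :: "'a set" and le :: "'a \<Rightarrow> 'a \<Rightarrow> bool" and \<Theta> :: "'a set set"
  assumes poset: "poset P le" and filter: "refinement_filter P le \<Theta>"
begin

abbreviation below (infix \<open>\<lhd>\<close> 50) where
  "p \<lhd> q \<equiv> unif_below P le \<Theta> p q"

abbreviation touches where
  "touches p q \<equiv> near P le \<Theta> {p, q}"

lemma le_refl: "p \<in> P \<Longrightarrow> le p p"
  using poset unfolding poset_def by (blast dest: reflp_onD)

lemma le_trans: "le p q \<Longrightarrow> le q r \<Longrightarrow> p \<in> P \<Longrightarrow> q \<in> P \<Longrightarrow> r \<in> P \<Longrightarrow> le p r"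
  using poset unfolding poset_def by (blast dest: transp_onD)

lemma le_antisym: "le p q \<Longrightarrow> le q p \<Longrightarrow> p \<in> P \<Longrightarrow> q \<in> P \<Longrightarrow> p = q"
  using poset unfolding poset_def by (blast dest: antisymp_onD)

lemma member_subset: "C \<in> \<Theta> \<Longrightarrow> C \<subseteq> P"
  using filter unfolding refinement_filter_def by blast

lemma refinement_closed: "C \<in> \<Theta> \<Longrightarrow> D \<subseteq> P \<Longrightarrow> refines le C D \<Longrightarrow> D \<in> \<Theta>"
  using filter unfolding refinement_filter_def refinement_closure_def by blast

lemma refines_refl: "C \<subseteq> P \<Longrightarrow> refines le C C"
  unfolding refines_def using le_refl by blast

lemma closure_eq: "refinement_closure P le \<Theta> = \<Theta>"
  using refinement_closed refines_refl member_subset unfolding refinement_closure_def by blast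

lemma nonempty: "\<exists>C. C \<in> \<Theta>"
proof -
  have "\<exists>C\<in>\<Theta>. \<forall>D\<in>{}. refines le C D"
    using filter unfolding refinement_filter_def refinement_directed_def by blast
  then show ?thesis by blast
qed

lemma common_refinement:
  assumes "C \<in> \<Theta>" "D \<in> \<Theta>"
  obtains E where "E \<in> \<Theta>" "refines le E C" "refines le E D"
proof -
  have "finite {C, D} \<and> {C, D} \<subseteq> \<Theta>"
    using assms by simp
  then have "\<exists>E\<in>\<Theta>. \<forall>A\<in>{C, D}. refines le E A"
    using filter unfolding refinement_filter_def refinement_directed_def by blast
  then show ?thesis
    using that by auto
qed

lemma near_iff: "near P le \<Theta> S \<longleftrightarrow> S \<subseteq> P \<and> (\<exists>D\<subseteq>P. D \<notin> \<Theta> \<and> (\<forall>s\<in>S. insert s D \<in> \<Theta>))"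
  unfolding near_def closure_eq by simp

lemma near_mono:
  assumes "near P le \<Theta> S" "T \<subseteq> P" "\<And>t. t \<in> T \<Longrightarrow> \<exists>s\<in>S. le s t"
  shows "near P le \<Theta> T"
proof -
  obtain D where D: "S \<subseteq> P" "D \<subseteq> P" "D \<notin> \<Theta>" "\<forall>s\<in>S. insert s D \<in> \<Theta>"
    using assms(1) unfolding near_iff by blast
  have "insert t D \<in> \<Theta>" if t: "t \<in> T" for t
  proof -
    obtain s where s: "s \<in> S" "le s t"
      using assms(3)[OF t] by blast
    have "refines le (insert s D) (insert t D)"
      using s D(2) le_refl unfolding refines_def by blast
    moreover have "insert s D \<in> \<Theta>" "insert t D \<subseteq> P"
      using D s assms(2) t by blast+
    ultimately show ?thesis
      using refinement_closed by blast
  qed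
  then show ?thesis
    unfolding near_iff using assms(2) D by blast
qed

lemma touches_common_lower_bound:
  assumes "near P le \<Theta> {t}" "le t p" "le t q" "p \<in> P" "q \<in> P"
  shows "touches p q"
  by (rule near_mono[OF assms(1)]) (use assms in auto)

lemma touches_mono:
  assumes "touches p q" "le p p'" "le q q'" "p' \<in> P" "q' \<in> P"
  shows "touches p' q'"
  by (rule near_mono[OF assms(1)]) (use assms in auto)

lemma touches_in: "touches p q \<Longrightarrow> p \<in> P \<and> q \<in> P"
  unfolding near_iff by blast

lemma below_iff:
  "p \<lhd> q \<longleftrightarrow> p \<in> P \<and> q \<in> P \<and> (\<exists>C\<in>\<Theta>. \<forall>c\<in>C. touches c p \<longrightarrow> le c q)"
  unfolding unif_below_def near_star_def by blast

lemma below_in: "p \<lhd> q \<Longrightarrow> p \<in> P \<and> q \<in> P"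
  unfolding below_iff by blast

text \<open>A family witnessing uniform inclusion may be replaced by any finer one, because being near
  is inherited by larger elements.\<close>

lemma star_bound_refine:
  assumes C: "\<forall>c\<in>C. touches c p \<longrightarrow> le c q" and E: "refines le E C" "E \<subseteq> P" "C \<subseteq> P"
    and q: "q \<in> P" and e: "e \<in> E" "touches e p"
  shows "le e q"
proof -
  obtain c where c: "c \<in> C" "le e c"
    using E e unfolding refines_def by blast
  then have "touches c p"
    using touches_mono[OF e(2)] touches_in[OF e(2)] le_refl E by blast
  then show ?thesis
    using C c e E q le_trans by blast
qed

lemma below_trans_le:
  assumes "le p' p" "p \<lhd> q" "le q q'" "p' \<in> P" "q' \<in> P"
  shows "p' \<lhd> q'"
proof -
  obtain C where C: "C \<in> \<Theta>" "\<forall>c\<in>C. touches c p \<longrightarrow> le c q"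
    using assms unfolding below_iff by blast
  have "le c q'" if c: "c \<in> C" "touches c p'" for c
  proof -
    have "touches c p"
      using touches_mono[OF c(2) le_refl assms(1)] touches_in[OF c(2)] below_in[OF assms(2)] by blast
    then show ?thesis
      using C c le_trans[OF _ assms(3)] below_in[OF assms(2)] assms(5) member_subset by blast
  qed
  then show ?thesis
    using assms C unfolding below_iff by blast
qed

text \<open>An element that is not near meets no member of a family, so the condition for uniform
  inclusion is vacuous.\<close>

lemma below_if_not_near:
  assumes "p \<in> P" "\<not> near P le \<Theta> {p}" "q \<in> P"
  shows "p \<lhd> q"
proof -
  have "\<not> touches c p" for c
    using near_mono[of "{c, p}" "{p}"] assms le_refl by blast
  then show ?thesis
    unfolding below_iff using assms nonempty by blast
qed

lemma filter_subset: "unif_below_filter P le \<Theta> R \<Longrightarrow> R \<subseteq> P"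
  by (simp add: unif_below_filter_def)

lemma filter_up: "unif_below_filter P le \<Theta> R \<Longrightarrow> r \<in> R \<Longrightarrow> r \<lhd> p \<Longrightarrow> p \<in> R"
  by (simp add: unif_below_filter_def unif_below_def)

lemma filter_lower_bound:
  "unif_below_filter P le \<Theta> R \<Longrightarrow> finite F \<Longrightarrow> F \<subseteq> R \<Longrightarrow> \<exists>s\<in>R. \<forall>f\<in>F. s \<lhd> f"
  unfolding unif_below_filter_def by blast

end

section \<open>The spectrum of an admissible filter\<close>

locale admissible_filter = refinement_poset +
  assumes admissible: "admissible P le \<Theta>"
begin

abbreviation regular where
  "regular \<equiv> regularisation P le \<Theta>"

abbreviation shrink where
  "shrink \<equiv> unif_shrink P le \<Theta>"

lemma below_le: "p \<lhd> q \<Longrightarrow> le p q"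
  using admissible below_in unfolding admissible_def is_supremum_def by blast

lemma le_if_below_le:
  "p \<in> P \<Longrightarrow> u \<in> P \<Longrightarrow> (\<And>q. q \<lhd> p \<Longrightarrow> le q u) \<Longrightarrow> le p u"
  using admissible below_in unfolding admissible_def is_supremum_def by blast

lemma near_if_not_least: "p \<in> P \<Longrightarrow> q \<in> P \<Longrightarrow> \<not> le p q \<Longrightarrow> near P le \<Theta> {p}"
  using below_if_not_near below_le by blast

lemma shrink_subset: "shrink C \<subseteq> P"
  unfolding unif_shrink_def by blast

lemma shrink_refines: "C \<subseteq> P \<Longrightarrow> refines le (shrink C) C"
  unfolding unif_shrink_def refines_def using below_le by blast

lemma shrink_mono: "refines le C D \<Longrightarrow> D \<subseteq> P \<Longrightarrow> refines le (shrink C) (shrink D)"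
  unfolding unif_shrink_def refines_def using below_trans_le le_refl by blast

lemma regular_eq: "regular = {(shrink ^^ n) C | n C. C \<in> \<Theta>}"
proof -
  have "regularisation_step P le \<Theta> n = (shrink ^^ n) ` \<Theta>" for n
    by (induction n) (auto simp: image_image)
  then show ?thesis
    unfolding regularisation_def by auto
qed

lemma regular_base: "C \<in> \<Theta> \<Longrightarrow> C \<in> regular"
  unfolding regular_eq by (metis (mono_tags, lifting) funpow_0 mem_Collect_eq)

lemma regular_shrink: "C \<in> regular \<Longrightarrow> shrink C \<in> regular"
  unfolding regular_eq by clarsimp (metis comp_apply funpow.simps(2))

lemma funpow_shrink_subset: "C \<subseteq> P \<Longrightarrow> (shrink ^^ n) C \<subseteq> P"
  using shrink_subset by (cases n) auto

text \<open>Shrinking more often only refines, so two members of \<open>\<Theta>\<^sup>R\<close> of different levels are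
  both refined by a common refinement in \<open>\<Theta>\<close> that is shrunk often enough.\<close>

lemma funpow_shrink_refines:
  assumes "refines le E C" "C \<subseteq> P" "E \<subseteq> P"
  shows "refines le ((shrink ^^ (n + m)) E) ((shrink ^^ n) C)"
proof (induction n)
  case 0
  have "refines le ((shrink ^^ m) E) E"
  proof (induction m)
    case 0
    then show ?case using refines_refl assms by simp
  next
    case (Suc m)
    have "refines le (shrink ((shrink ^^ m) E)) ((shrink ^^ m) E)"
      using shrink_refines funpow_shrink_subset assms by blast
    then show ?case
      using refines_trans[OF poset shrink_subset funpow_shrink_subset[OF assms(3)] assms(3) _ Suc]
      by simp
  qed
  then have "refines le ((shrink ^^ m) E) C"
    using refines_trans[OF poset funpow_shrink_subset[OF assms(3)] assms(3,2) _ assms(1)] by blast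
  then show ?case
    by simp
next
  case (Suc n)
  then show ?case
    using shrink_mono[OF Suc funpow_shrink_subset[OF assms(2)]] by simp
qed

lemma regular_common_refinement:
  assumes "C \<in> regular" "D \<in> regular"
  obtains E where "E \<in> regular" "refines le E C" "refines le E D"
proof -
  obtain n m A B where eq: "C = (shrink ^^ n) A" "D = (shrink ^^ m) B" "A \<in> \<Theta>" "B \<in> \<Theta>"
    using assms unfolding regular_eq by blast
  obtain F where F: "F \<in> \<Theta>" "refines le F A" "refines le F B"
    using common_refinement eq by blast
  have "refines le ((shrink ^^ (n + m)) F) C" "refines le ((shrink ^^ (n + m)) F) D"
    using funpow_shrink_refines[of F A n m] funpow_shrink_refines[of F B m n] F eq member_subset
    by (auto simp: add.commute)
  moreover have "(shrink ^^ (n + m)) F \<in> regular"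
    unfolding regular_eq using F by blast
  ultimately show ?thesis
    using that by blast
qed

lemma shrink_subset_least:
  assumes "C \<subseteq> P" "t \<in> P" "\<And>p. p \<in> P \<Longrightarrow> le t p" "shrink C \<subseteq> {t}"
  shows "C \<subseteq> {t}"
proof
  fix c assume c: "c \<in> C"
  have "le c t"
  proof (rule le_if_below_le)
    fix q assume "q \<lhd> c"
    then have "q \<in> shrink C"
      using c below_in unfolding unif_shrink_def by blast
    then show "le q t"
      using assms le_refl by blast
  qed (use c assms in auto)
  then show "c \<in> {t}"
    using le_antisym assms c by blast
qed

text \<open>A round Cauchy up-set has no room for an element that is not near: such an element
  would be the least one, roundness would then provide a family of \<open>\<Theta>\<^sup>R\<close> that consists of it
  alone, and by admissibility this family stems from a member of \<open>\<Theta>\<close> of the same kind, making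
  the element near after all.\<close>

lemma spectrum_near:
  assumes R: "R \<in> spectrum P le regular" and t: "t \<in> R"
  shows "near P le \<Theta> {t}"
proof (rule ccontr)
  assume nn: "\<not> near P le \<Theta> {t}"
  have up: "up_set P le R" and cauchy: "set_cauchy regular R" and round: "set_round le regular R"
    using R unfolding spectrum_def by auto
  have tP: "t \<in> P"
    using up t unfolding up_set_def by blast
  have least: "le t p" if "p \<in> P" for p
    using below_le below_if_not_near[OF tP nn that] .
  then have "R = P"
    using up t unfolding up_set_def by blast
  obtain C' where "C' \<in> regular" "\<forall>c\<in>C' \<inter> R. le c t"
    using round t unfolding set_round_def by blast
  then obtain n C where C: "C \<in> \<Theta>" "\<forall>c\<in>(shrink ^^ n) C. le c t"
    using funpow_shrink_subset member_subset \<open>R = P\<close> unfolding regular_eq by blast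
  have "(shrink ^^ n) C \<subseteq> {t}"
    using C least le_antisym tP funpow_shrink_subset[OF member_subset] by blast
  then have "C \<subseteq> {t}"
  proof (induction n)
    case (Suc n)
    then show ?case
      using shrink_subset_least[OF funpow_shrink_subset[OF member_subset[OF C(1)]] tP least] by simp
  qed simp
  then have "{t} \<in> \<Theta>"
    using refinement_closed[OF C(1), of "{t}"] tP le_refl unfolding refines_def by blast
  moreover have "{} \<notin> \<Theta>"
    using cauchy regular_base unfolding set_cauchy_def by blast
  ultimately have "near P le \<Theta> {t}"
    unfolding near_iff using tP by blast
  with nn show False ..
qed

text \<open>Roundness at \<open>p\<close> and at \<open>q\<close> provides families whose members in \<open>R\<close> are all below
  \<open>p\<close> and \<open>q\<close> respectively.  A common refinement still has a member in \<open>R\<close>, and so do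
  the two families above that member, which is therefore below \<open>p\<close> and \<open>q\<close>.\<close>

lemma spectrum_lower_bound:
  assumes R: "R \<in> spectrum P le regular" and "p \<in> R" "q \<in> R"
  obtains t where "t \<in> R" "le t p" "le t q"
proof -
  have up: "up_set P le R" and cauchy: "set_cauchy regular R" and round: "set_round le regular R"
    using R unfolding spectrum_def by auto
  obtain C D where C: "C \<in> regular" "\<forall>c\<in>C \<inter> R. le c p" and D: "D \<in> regular" "\<forall>c\<in>D \<inter> R. le c q"
    using round assms unfolding set_round_def by meson
  obtain E where E: "E \<in> regular" "refines le E C" "refines le E D"
    using regular_common_refinement C D by blast
  obtain t where t: "t \<in> E" "t \<in> R"
    using cauchy E unfolding set_cauchy_def by blast
  have sub: "A \<subseteq> P" if "A \<in> regular" for A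
    using that funpow_shrink_subset member_subset unfolding regular_eq by blast
  have "le t r" if r: "r \<in> R" and EA: "refines le E A" and A: "A \<in> regular" "\<forall>c\<in>A \<inter> R. le c r" for A r
  proof -
    obtain a where a: "a \<in> A" "le t a"
      using EA t unfolding refines_def by blast
    then have "a \<in> R" "t \<in> P" "a \<in> P" "r \<in> P"
      using t r sub[OF A(1)] up unfolding up_set_def by blast+
    then show ?thesis
      using A(2) a le_trans by blast
  qed
  then have "le t p" "le t q"
    using C D E assms(2,3) by blast+
  then show ?thesis
    using that t(2) by blast
qed

text \<open>A \<open>\<lhd>\<close>-filter of near elements is round already for \<open>\<Theta>\<close> itself: if \<open>C\<close> witnesses
  \<open>s \<lhd> r\<close>, then every member of \<open>C\<close> in the filter has a common lower bound with \<open>s\<close>, hence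
  lies below \<open>r\<close>.\<close>

lemma filter_round:
  assumes "unif_below_filter P le \<Theta> R" "R \<subseteq> near_elements P le \<Theta>" "r \<in> R"
  obtains C where "C \<in> \<Theta>" "\<And>c. c \<in> C \<Longrightarrow> c \<in> R \<Longrightarrow> le c r"
proof -
  obtain s where s: "s \<in> R" "s \<lhd> r"
    using filter_lower_bound[OF assms(1), of "{r}"] assms(3) by auto
  then obtain C where C: "C \<in> \<Theta>" "\<forall>c\<in>C. touches c s \<longrightarrow> le c r"
    unfolding below_iff by blast
  have "le c r" if c: "c \<in> C" "c \<in> R" for c
  proof -
    obtain t where t: "t \<in> R" "t \<lhd> c" "t \<lhd> s"
      using filter_lower_bound[OF assms(1), of "{c, s}"] s c by auto
    then have "near P le \<Theta> {t}"
      using assms(2) unfolding near_elements_def by blast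
    then have "touches c s"
      using touches_common_lower_bound t(2,3)[THEN below_le] t(2,3)[THEN below_in] by blast
    then show ?thesis
      using C c by blast
  qed
  then show ?thesis
    using that C by blast
qed

text \<open>A round Cauchy up-set meets the shrinking of the family that bounds a given element, and
  thus contains an element uniformly below it; this is what the regularisation is for.  Conversely,
  a \<open>\<lhd>\<close>-filter meets the shrinking of each family that it meets, because each of its elements
  has another one uniformly below it.\<close>

lemma spectrum_eq:
  "spectrum P le regular =
    {R. R \<subseteq> near_elements P le \<Theta> \<and> set_cauchy \<Theta> R \<and> unif_below_filter P le \<Theta> R}"
proof (intro set_eqI iffI CollectI conjI)
  fix R assume R: "R \<in> spectrum P le regular"
  have up: "up_set P le R" and cauchy: "set_cauchy regular R" and round: "set_round le regular R"
    using R unfolding spectrum_def by auto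
  have RP: "R \<subseteq> P"
    using up unfolding up_set_def by blast
  show "R \<subseteq> near_elements P le \<Theta>"
    using spectrum_near[OF R] RP unfolding near_elements_def by blast
  show \<Theta>: "set_cauchy \<Theta> R"
    using cauchy regular_base unfolding set_cauchy_def by blast
  have step: "\<exists>s\<in>R. s \<lhd> r" if r: "r \<in> R" for r
  proof -
    obtain C where C: "C \<in> regular" "\<forall>c\<in>C \<inter> R. le c r"
      using round r unfolding set_round_def by blast
    obtain s where "s \<in> R" "s \<in> shrink C"
      using cauchy regular_shrink[OF C(1)] unfolding set_cauchy_def by blast
    then obtain c where c: "c \<in> C" "s \<lhd> c"
      unfolding unif_shrink_def by blast
    then have "c \<in> R"
      using up \<open>s \<in> R\<close> below_le below_in unfolding up_set_def by blast
    then show ?thesis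
      using C c \<open>s \<in> R\<close> below_trans_le[of s s c r] RP r le_refl by blast
  qed
  have low: "\<exists>s\<in>R. \<forall>f\<in>F. s \<lhd> f" if "finite F" "F \<subseteq> R" for F
    using that
  proof (induction F rule: finite_induct)
    case empty
    then show ?case
      using \<Theta> nonempty unfolding set_cauchy_def by blast
  next
    case (insert f F)
    then obtain s s' where s: "s \<in> R" "\<forall>f\<in>F. s \<lhd> f" and s': "s' \<in> R" "s' \<lhd> f"
      using step[of f] by auto
    obtain t where t: "t \<in> R" "le t s" "le t s'"
      using spectrum_lower_bound[OF R s(1) s'(1)] by blast
    have "t \<lhd> g" if "g \<in> insert f F" for g
      using that s s' t below_trans_le[of t] below_in le_refl RP by blast
    then show ?case
      using t by blast
  qed
  have "p \<in> R" if "r \<in> R" "p \<in> P" "r \<lhd> p" for r p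
    using that up below_le unfolding up_set_def by blast
  then show "unif_below_filter P le \<Theta> R"
    unfolding unif_below_filter_def using RP low by simp
next
  fix R assume "R \<in> {R. R \<subseteq> near_elements P le \<Theta> \<and> set_cauchy \<Theta> R \<and> unif_below_filter P le \<Theta> R}"
  then have near: "R \<subseteq> near_elements P le \<Theta>" and cauchy: "set_cauchy \<Theta> R"
    and fil: "unif_below_filter P le \<Theta> R" by auto
  have RP: "R \<subseteq> P"
    using filter_subset[OF fil] .
  have step: "\<exists>s\<in>R. s \<lhd> r" if "r \<in> R" for r
    using filter_lower_bound[OF fil, of "{r}"] that by simp
  have up: "up_set P le R"
    unfolding up_set_def
  proof (intro conjI ballI impI RP)
    fix r p assume rp: "r \<in> R" "p \<in> P" "le r p"
    obtain s where s: "s \<in> R" "s \<lhd> r"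
      using step rp by blast
    then have "s \<lhd> p"
      using below_trans_le[of s s r p] rp le_refl RP by blast
    then show "p \<in> R"
      using filter_up[OF fil s(1)] by blast
  qed
  have "(shrink ^^ n) C \<inter> R \<noteq> {}" if "C \<in> \<Theta>" for n C
  proof (induction n)
    case 0
    then show ?case using cauchy that unfolding set_cauchy_def by simp
  next
    case (Suc n)
    then obtain c where c: "c \<in> (shrink ^^ n) C" "c \<in> R" by blast
    obtain s where "s \<in> R" "s \<lhd> c"
      using step c by blast
    then show ?case
      using c RP unfolding unif_shrink_def by auto
  qed
  then have "set_cauchy regular R"
    unfolding set_cauchy_def regular_eq by blast
  moreover have "set_round le regular R"
    unfolding set_round_def using filter_round[OF fil near] regular_base by (metis IntE)
  ultimately show "R \<in> spectrum P le regular"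
    using up unfolding spectrum_def by blast
qed

end

section \<open>The spectrum represents the poset\<close>

context admissible_filter
begin

abbreviation Y where
  "Y \<equiv> spectrum_topology P le regular"

abbreviation U where
  "U \<equiv> spectrum_open P le regular"

lemma up_setD: "up_set P le R \<Longrightarrow> r \<in> R \<Longrightarrow> p \<in> P \<Longrightarrow> le r p \<Longrightarrow> p \<in> R"
  by (simp add: up_set_def)

lemma spectrum_in:
  assumes "R \<in> spectrum P le regular"
  shows "R \<subseteq> near_elements P le \<Theta>" "set_cauchy \<Theta> R" "unif_below_filter P le \<Theta> R" "up_set P le R"
proof -
  have "R \<in> {R. R \<subseteq> near_elements P le \<Theta> \<and> set_cauchy \<Theta> R \<and> unif_below_filter P le \<Theta> R}"
    using assms unfolding spectrum_eq .
  then show "R \<subseteq> near_elements P le \<Theta>" "set_cauchy \<Theta> R" "unif_below_filter P le \<Theta> R"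
    by simp_all
  show "up_set P le R"
    using assms by (simp add: spectrum_def)
qed

lemma U_mono: "p \<in> P \<Longrightarrow> q \<in> P \<Longrightarrow> le p q \<Longrightarrow> U p \<subseteq> U q"
  unfolding spectrum_open_def using up_setD[OF spectrum_in(4)] by blast

lemma openin_U: "p \<in> P \<Longrightarrow> openin Y (U p)"
  unfolding spectrum_topology_def by (rule topology_generated_by_Basis) blast

text \<open>The subbasis is a basis because the points of the spectrum are down-directed.\<close>

lemma spectrum_basis: "is_basis_of Y (U ` P)"
proof (rule is_basis_ofI)
  fix W R assume W: "openin Y W" and R: "R \<in> W"
  have gen: "generate_topology_on (insert (spectrum P le regular) (U ` P)) W"
    using W unfolding spectrum_topology_def openin_topology_generated_by_iff .
  have RS: "R \<in> spectrum P le regular"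
    using openin_subset[OF W] R by auto
  have RP: "R \<subseteq> P"
    using spectrum_in(4)[OF RS] unfolding up_set_def by blast
  have "\<exists>p\<in>R. U p \<subseteq> W"
    using gen R
  proof induction
    case (Int a b)
    then obtain p q where pq: "p \<in> R" "U p \<subseteq> a" "q \<in> R" "U q \<subseteq> b"
      by blast
    obtain t where "t \<in> R" "le t p" "le t q"
      using spectrum_lower_bound[OF RS pq(1,3)] by blast
    moreover from this have "U t \<subseteq> U p" "U t \<subseteq> U q"
      using U_mono pq RP by blast+
    ultimately show ?case
      using pq by blast
  next
    case (UN K)
    then show ?case by blast
  next
    case (Basis s)
    obtain p where "p \<in> R"
      using spectrum_in(2)[OF RS] nonempty unfolding set_cauchy_def by blast
    then show ?case
      using Basis unfolding spectrum_open_def by auto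
  qed simp
  then show "\<exists>b\<in>U ` P. R \<in> b \<and> b \<subseteq> W"
    using RS RP unfolding spectrum_open_def by blast
qed (use openin_U in blast)

lemma spectrum_t0: "t0_space Y"
  unfolding t0_space_def
proof (intro ballI impI)
  fix R S assume "R \<in> topspace Y" "S \<in> topspace Y" and ne: "R \<noteq> S"
  then have RS: "R \<in> spectrum P le regular" "S \<in> spectrum P le regular"
    by simp_all
  obtain p where p: "p \<in> R \<union> S" "p \<in> R \<longleftrightarrow> p \<notin> S"
    using ne by blast
  have "R \<subseteq> P" "S \<subseteq> P"
    using RS[THEN spectrum_in(4)] by (simp_all add: up_set_def)
  then have "openin Y (U p)"
    using openin_U p(1) by blast
  moreover have "R \<notin> U p \<longleftrightarrow> S \<in> U p"
    using p(2) RS by (simp add: spectrum_open_def)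
  ultimately show "\<exists>W. openin Y W \<and> (R \<notin> W \<longleftrightarrow> S \<in> W)"
    by blast
qed

text \<open>An element is the supremum of those elements below it that also lie below some member of a
  given \<open>C \<in> \<Theta>\<close>.  For if \<open>q\<close> bounds all of these and \<open>p' \<lhd> p\<close>, then a family witnessing
  this and refining \<open>C\<close> witnesses \<open>p' \<lhd> q\<close> as well.\<close>

lemma ex_below_in_member:
  assumes p: "p \<in> P" and q: "q \<in> P" and pq: "\<not> le p q" and C: "C \<in> \<Theta>"
  shows "\<exists>r c. r \<lhd> p \<and> \<not> le r q \<and> c \<in> C \<and> le r c"
proof (rule ccontr)
  assume neg: "\<not> ?thesis"
  have le_q: "le e q" if e: "e \<in> P" "le e p" "c \<in> C" "le e c" for e c
  proof (rule le_if_below_le[OF e(1) q])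
    fix s assume s: "s \<lhd> e"
    have "c \<in> P"
      using member_subset C e by blast
    have "s \<lhd> p" "s \<lhd> c"
      using below_trans_le[OF le_refl s] s[THEN below_in] e p \<open>c \<in> P\<close> by blast+
    then show "le s q"
      using neg e(3) below_le by blast
  qed
  have "le p q"
  proof (rule le_if_below_le[OF p q])
    fix p' assume p': "p' \<lhd> p"
    then obtain D where D: "D \<in> \<Theta>" "\<forall>c\<in>D. touches c p' \<longrightarrow> le c p"
      unfolding below_iff by blast
    obtain E where E: "E \<in> \<Theta>" "refines le E C" "refines le E D"
      using common_refinement[OF C D(1)] .
    have "le e q" if e: "e \<in> E" "touches e p'" for e
    proof -
      have "le e p"
        using star_bound_refine[OF D(2) E(3) _ _ p e] member_subset D E by blast
      moreover obtain c where "c \<in> C" "le e c"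
        using E(2) e unfolding refines_def by blast
      ultimately show ?thesis
        using le_q member_subset[OF E(1)] e by blast
    qed
    then have "p' \<lhd> q"
      unfolding below_iff using E(1) q below_in[OF p'] by blast
    then show "le p' q"
      by (rule below_le)
  qed
  with pq show False ..
qed

text \<open>If \<open>p\<close> is not below \<open>q\<close>, then a \<open>\<lhd>\<close>-decreasing sequence can be started at \<open>p\<close> that
  enters the members of a countable base one by one and never falls below \<open>q\<close>.  The up-set it
  generates is a point of the spectrum that contains \<open>p\<close> but not \<open>q\<close>.  Countability is what
  lets one sequence take care of all families.\<close>

lemma spectrum_separates:
  assumes cf: "countable_filter P le \<Theta>" and p: "p \<in> P" and q: "q \<in> P" and pq: "\<not> le p q"
  obtains R where "R \<in> spectrum P le regular" "p \<in> R" "q \<notin> R"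
proof -
  obtain B where B: "\<And>n. B n \<in> \<Theta>" "\<And>n. refines le (B (Suc n)) (B n)"
      "\<And>C. C \<in> \<Theta> \<Longrightarrow> \<exists>n. refines le (B n) C"
    using countable_filter_sequence[OF poset cf] by blast
  define good where "good n r \<longleftrightarrow> r \<in> P \<and> \<not> le r q \<and> (n = 0 \<longrightarrow> r = p)" for n :: nat and r
  define nxt where "nxt n r r' \<longleftrightarrow> r' \<lhd> r \<and> (\<exists>b\<in>B n. le r' b)" for n r r'
  have "\<exists>r'. good (Suc n) r' \<and> nxt n r r'" if "good n r" for n r
  proof -
    obtain r' c where "r' \<lhd> r" "\<not> le r' q" "c \<in> B n" "le r' c"
      using ex_below_in_member[OF _ q _ B(1), of r n] \<open>good n r\<close> unfolding good_def by blast
    then have "good (Suc n) r'" "nxt n r r'"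
      using below_in[of r' r] unfolding good_def nxt_def by blast+
    then show ?thesis
      by blast
  qed
  moreover have "good 0 p"
    unfolding good_def using p pq by blast
  ultimately obtain x where x: "\<And>n. good n (x n)" "\<And>n. nxt n (x n) (x (Suc n))"
    using dependent_nat_choice[of good nxt] by blast
  have xP: "x n \<in> P" "\<not> le (x n) q" and x0: "x 0 = p" for n
    using x(1) unfolding good_def by blast+
  have xs: "x (Suc n) \<lhd> x n" and xB: "\<exists>b\<in>B n. le (x (Suc n)) b" for n
    using x(2) unfolding nxt_def by blast+
  have dec: "le (x (n + k)) (x n)" for n k
  proof (induction k)
    case (Suc k)
    then show ?case
      using le_trans[OF below_le[OF xs[of "n + k"]] Suc] xP by simp
  qed (simp add: le_refl xP)
  define R where "R = {r \<in> P. \<exists>n. le (x n) r}"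
  have down: "x (Suc (n + k)) \<lhd> r" if "le (x n) r" "r \<in> P" for n k r
    using below_trans_le[OF le_refl xs[of "n + k"] le_trans[OF dec that(1)]] xP that by blast
  have xR: "x n \<in> R" for n
    unfolding R_def using xP le_refl by blast
  have "R \<subseteq> near_elements P le \<Theta>"
  proof
    fix r assume "r \<in> R"
    then obtain n where "r \<in> P" "le (x n) r"
      unfolding R_def by blast
    then show "r \<in> near_elements P le \<Theta>"
      using near_if_not_least[OF p q pq] near_mono[OF near_if_not_least[of "x n" q], of "{r}"] xP q
      unfolding near_elements_def by blast
  qed
  moreover have "set_cauchy \<Theta> R"
    unfolding set_cauchy_def
  proof
    fix C assume C: "C \<in> \<Theta>"
    then obtain n where "refines le (B n) C"
      using B(3) by blast
    then obtain b c where bc: "b \<in> B n" "le (x (Suc n)) b" "c \<in> C" "le b c"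
      using xB[of n] unfolding refines_def by blast
    then have "b \<in> P" "c \<in> P"
      using member_subset B(1) C by blast+
    then have "c \<in> R"
      unfolding R_def using le_trans[OF bc(2,4)] xP by blast
    then show "C \<inter> R \<noteq> {}"
      using bc by blast
  qed
  moreover have "unif_below_filter P le \<Theta> R"
    unfolding unif_below_filter_def
  proof (intro conjI ballI impI allI)
    show "R \<subseteq> P"
      unfolding R_def by blast
    fix r r' assume "r \<in> R" "r' \<in> P" "r \<lhd> r'"
    then show "r' \<in> R"
      unfolding R_def using le_trans[OF _ below_le] xP by blast
  next
    fix F assume "finite F \<and> F \<subseteq> R"
    then have "finite F" "F \<subseteq> R"
      by auto
    then have "\<exists>n. \<forall>f\<in>F. le (x n) f"
    proof (induction F rule: finite_induct)
      case (insert f F)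
      then obtain n m where nm: "\<forall>g\<in>F. le (x n) g" "le (x m) f"
        unfolding R_def by blast
      have "le (x (n + m)) g" if "g \<in> insert f F" for g
      proof (cases "g = f")
        case True
        then show ?thesis
          using le_trans[OF dec[of m n] nm(2)] insert.prems xP unfolding R_def
          by (auto simp: add.commute)
      next
        case False
        then have "g \<in> F"
          using that by blast
        then show ?thesis
          using le_trans[OF dec[of n m]] nm(1) insert.prems xP unfolding R_def by blast
      qed
      then show ?case
        by blast
    qed blast
    then obtain n where "\<forall>f\<in>F. le (x n) f"
      by blast
    then have "\<forall>f\<in>F. x (Suc n) \<lhd> f"
      using down[of n _ 0] \<open>F \<subseteq> R\<close> unfolding R_def by auto
    then show "\<exists>s\<in>R. \<forall>f\<in>F. s \<lhd> f"
      using xR by blast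
  qed
  ultimately have "R \<in> spectrum P le regular"
    unfolding spectrum_eq by blast
  moreover have "p \<in> R"
    using xR[of 0] x0 by simp
  moreover have "q \<notin> R"
    unfolding R_def using xP by blast
  ultimately show thesis
    using that by blast
qed

lemma le_iff_U_subset:
  assumes "countable_filter P le \<Theta>" "p \<in> P" "q \<in> P"
  shows "le p q \<longleftrightarrow> U p \<subseteq> U q"
proof
  show "le p q \<Longrightarrow> U p \<subseteq> U q"
    by (rule U_mono[OF assms(2,3)])
  show "le p q" if "U p \<subseteq> U q"
  proof (rule ccontr)
    assume "\<not> le p q"
    then obtain R where "R \<in> spectrum P le regular" "p \<in> R" "q \<notin> R"
      using spectrum_separates[OF assms] by blast
    then show False
      using \<open>U p \<subseteq> U q\<close> unfolding spectrum_open_def by blast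
  qed
qed

end

text \<open>Filters of families, nearness and uniform inclusion only depend on the order, so they carry
  over along the order isomorphism \<open>p \<mapsto> U\<^sub>p\<close>.\<close>

locale order_representation = refinement_poset +
  fixes U :: "'a \<Rightarrow> 'b set"
  assumes le_iff: "p \<in> P \<Longrightarrow> q \<in> P \<Longrightarrow> le p q \<longleftrightarrow> U p \<subseteq> U q"
begin

abbreviation \<Theta>' where
  "\<Theta>' \<equiv> (\<lambda>C. U ` C) ` \<Theta>"

lemma inj_U: "inj_on U P"
  by (rule inj_onI) (simp add: le_antisym le_iff)

lemma refines_image_iff:
  "C \<subseteq> P \<Longrightarrow> D \<subseteq> P \<Longrightarrow> refines (\<subseteq>) (U ` C) (U ` D) \<longleftrightarrow> refines le C D"
proof -
  assume CD: "C \<subseteq> P" "D \<subseteq> P"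
  have "(\<exists>d\<in>D. U c \<subseteq> U d) \<longleftrightarrow> (\<exists>d\<in>D. le c d)" if "c \<in> C" for c
    using CD that le_iff by blast
  then show ?thesis
    unfolding refines_def by simp
qed

lemma image_mem_iff:
  assumes "D \<subseteq> P"
  shows "U ` D \<in> \<Theta>' \<longleftrightarrow> D \<in> \<Theta>"
proof
  assume "U ` D \<in> \<Theta>'"
  then obtain C where "C \<in> \<Theta>" "U ` D = U ` C"
    by blast
  then show "D \<in> \<Theta>"
    using inj_on_image_eq_iff[OF inj_U assms member_subset] by simp
qed blast

lemma poset_image: "poset (U ` P) (\<subseteq>)"
  unfolding poset_def reflp_on_def antisymp_on_def transp_on_def by blast

lemma filter_image: "refinement_filter (U ` P) (\<subseteq>) \<Theta>'"
  unfolding refinement_filter_def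
proof (intro conjI)
  show "\<Theta>' \<subseteq> Pow (U ` P)"
    by (auto dest: member_subset)
  show "refinement_directed (\<subseteq>) \<Theta>'"
    unfolding refinement_directed_def
  proof (intro allI impI)
    fix \<G> assume "finite \<G> \<and> \<G> \<subseteq> \<Theta>'"
    then obtain \<H> where \<H>: "\<H> \<subseteq> \<Theta>" "finite \<H>" "\<G> = (\<lambda>C. U ` C) ` \<H>"
      using finite_subset_image[of \<G> "\<lambda>C. U ` C" \<Theta>] by blast
    moreover have "\<exists>C\<in>\<Theta>. \<forall>D\<in>\<H>. refines le C D"
      using filter \<H>(1,2) unfolding refinement_filter_def refinement_directed_def by simp
    ultimately obtain C where C: "C \<in> \<Theta>" "\<forall>D\<in>\<H>. refines le C D"
      by blast
    have "\<forall>D\<in>\<H>. refines (\<subseteq>) (U ` C) (U ` D)"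
      using C \<H>(1) refines_image_iff[OF member_subset member_subset] by blast
    then have "\<forall>D\<in>\<G>. refines (\<subseteq>) (U ` C) D"
      unfolding \<H>(3) by simp
    then show "\<exists>C\<in>\<Theta>'. \<forall>D\<in>\<G>. refines (\<subseteq>) C D"
      by (intro bexI[of _ "U ` C"] imageI C(1))
  qed
  show "refinement_closure (U ` P) (\<subseteq>) \<Theta>' \<subseteq> \<Theta>'"
  proof
    fix D' assume "D' \<in> refinement_closure (U ` P) (\<subseteq>) \<Theta>'"
    then obtain D C where D: "D' = U ` D" "D \<subseteq> P" and C: "C \<in> \<Theta>" "refines (\<subseteq>) (U ` C) D'"
      unfolding refinement_closure_def by (auto simp: subset_image_iff)
    then have "D \<in> \<Theta>"
      using refinement_closed[OF C(1) D(2)] refines_image_iff[OF member_subset[OF C(1)] D(2)] by simp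
    then show "D' \<in> \<Theta>'"
      using D(1) by simp
  qed
qed

lemma countable_filter_image:
  assumes "countable_filter P le \<Theta>"
  shows "countable_filter (U ` P) (\<subseteq>) \<Theta>'"
proof -
  obtain \<Psi> where \<Psi>: "\<Psi> \<subseteq> \<Theta>" "countable \<Psi>" "\<forall>C\<in>\<Theta>. \<exists>B\<in>\<Psi>. refines le B C"
    using assms unfolding countable_filter_def by blast
  have "\<exists>B\<in>(\<lambda>C. U ` C) ` \<Psi>. refines (\<subseteq>) B (U ` C)" if C: "C \<in> \<Theta>" for C
  proof -
    obtain B where B: "B \<in> \<Psi>" "refines le B C"
      using \<Psi>(3) C by blast
    then have "refines (\<subseteq>) (U ` B) (U ` C)"
      using refines_image_iff member_subset \<Psi>(1) C by blast
    then show ?thesis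
      using B(1) by blast
  qed
  moreover have "(\<lambda>C. U ` C) ` \<Psi> \<subseteq> \<Theta>'" "countable ((\<lambda>C. U ` C) ` \<Psi>)"
    using \<Psi> by auto
  ultimately show ?thesis
    unfolding countable_filter_def using filter_image by (intro conjI exI[of _ "(\<lambda>C. U ` C) ` \<Psi>"]) auto
qed

sublocale image: refinement_poset "U ` P" "(\<subseteq>)" \<Theta>'
  by unfold_locales (rule poset_image filter_image)+

lemma near_image_iff:
  assumes S: "S \<subseteq> P"
  shows "near (U ` P) (\<subseteq>) \<Theta>' (U ` S) \<longleftrightarrow> near P le \<Theta> S"
proof -
  have "(\<exists>D'\<subseteq>U ` P. D' \<notin> \<Theta>' \<and> (\<forall>s\<in>U ` S. insert s D' \<in> \<Theta>')) \<longleftrightarrow>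
      (\<exists>D\<subseteq>P. U ` D \<notin> \<Theta>' \<and> (\<forall>s\<in>S. U ` insert s D \<in> \<Theta>'))"
    by (auto simp: subset_image_iff)
  also have "\<dots> \<longleftrightarrow> (\<exists>D\<subseteq>P. D \<notin> \<Theta> \<and> (\<forall>s\<in>S. insert s D \<in> \<Theta>))"
  proof -
    have "U ` insert s D \<in> \<Theta>' \<longleftrightarrow> insert s D \<in> \<Theta>" if "D \<subseteq> P" "s \<in> S" for s D
      by (rule image_mem_iff) (use that S in blast)
    then show ?thesis
      using image_mem_iff by metis
  qed
  finally show ?thesis
    unfolding near_iff image.near_iff using S by auto
qed

lemma below_image_iff:
  assumes "p \<in> P" "q \<in> P"
  shows "image.below (U p) (U q) \<longleftrightarrow> p \<lhd> q"
proof -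
  have "(\<forall>c\<in>U ` C. image.touches c (U p) \<longrightarrow> c \<subseteq> U q) \<longleftrightarrow> (\<forall>c\<in>C. touches c p \<longrightarrow> le c q)"
    if "C \<in> \<Theta>" for C
    using near_image_iff[of "{_, p}"] le_iff assms member_subset[OF that] by (auto simp: subset_iff)
  then show ?thesis
    unfolding below_iff image.below_iff using assms by auto
qed

end

section \<open>Metrics from sequences of entourages\<close>

text \<open>This is \<open>2\<^sup>-\<^sup>k\<close> for the largest \<open>k\<close> with \<open>G\<^sub>k x y\<close>, and \<open>0\<close> if these \<open>k\<close> are
  unbounded.\<close>

definition gauge :: "(nat \<Rightarrow> 'a \<Rightarrow> 'a \<Rightarrow> bool) \<Rightarrow> 'a \<Rightarrow> 'a \<Rightarrow> real" where
  "gauge G x y = Inf {(1/2) ^ k |k. G k x y}"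

text \<open>The number of edges is recorded besides the cost, as the bound for chains is proved by
  induction on it.\<close>

inductive chain :: "('a \<Rightarrow> 'a \<Rightarrow> real) \<Rightarrow> nat \<Rightarrow> 'a \<Rightarrow> 'a \<Rightarrow> real \<Rightarrow> bool" for \<rho> where
  stop: "chain \<rho> 0 x x 0"
| step: "chain \<rho> n x y c \<Longrightarrow> chain \<rho> (Suc n) x z (c + \<rho> y z)"

lemma chain_nonneg: "chain \<rho> n x y c \<Longrightarrow> (\<And>x y. 0 \<le> \<rho> x y) \<Longrightarrow> 0 \<le> c"
  by (induction rule: chain.induct) auto

lemma chain_append: "chain \<rho> m y z b \<Longrightarrow> chain \<rho> n x y a \<Longrightarrow> chain \<rho> (n + m) x z (a + b)"
proof (induction rule: chain.induct)
  case (step m y w c z)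
  then show ?case
    using chain.step[of \<rho> "n + m" x w "a + c" z] by (simp add: add.assoc)
qed simp

lemma chain_single: "chain \<rho> 1 x y (\<rho> x y)"
  using chain.step[OF chain.stop, of \<rho> x y] by simp

lemma chain_reverse:
  assumes "\<And>x y. \<rho> x y = \<rho> y x"
  shows "chain \<rho> n x y c \<Longrightarrow> chain \<rho> n y x c"
proof (induction rule: chain.induct)
  case (step n x y c z)
  then show ?case
    using chain_append[OF step.IH chain_single[of \<rho> z y]] assms[of y z] by (simp add: add.commute)
qed (rule chain.stop)

text \<open>Cutting at the edge where the accumulated cost passes \<open>h\<close>.\<close>

lemma chain_split:
  assumes "\<And>x y. 0 \<le> \<rho> x y" "0 \<le> h"
  shows "chain \<rho> n x y c \<Longrightarrow> n > 0 \<Longrightarrow> \<exists>m l u v a b. m < n \<and> l < n \<and> chain \<rho> m x u a \<and>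
    chain \<rho> l v y b \<and> a \<le> h \<and> b \<le> max 0 (c - h) \<and> a + \<rho> u v + b = c"
proof (induction rule: chain.induct)
  case (step n x y c z)
  show ?case
  proof (cases "c \<le> h")
    case True
    have "chain \<rho> 0 z z 0" by (rule chain.stop)
    with step.hyps True show ?thesis
      by (intro exI[of _ n] exI[of _ 0] exI[of _ y] exI[of _ z] exI[of _ c]) auto
  next
    case False
    have "n > 0"
    proof (rule ccontr)
      assume "\<not> n > 0"
      then have "c = 0"
        using step.hyps by (auto elim: chain.cases)
      with False assms(2) show False by simp
    qed
    from step.IH[OF this] obtain m l u v a b where IH: "m < n" "l < n" "chain \<rho> m x u a"
      "chain \<rho> l v y b" "a \<le> h" "b \<le> max 0 (c - h)" "a + \<rho> u v + b = c"
      by blast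
    have "chain \<rho> (Suc l) v z (b + \<rho> y z)"
      using IH(4) by (rule chain.step)
    moreover have "b + \<rho> y z \<le> max 0 (c + \<rho> y z - h)"
      using IH(6) False by auto
    ultimately show ?thesis
      using IH by (intro exI[of _ m] exI[of _ "Suc l"] exI[of _ u] exI[of _ v] exI[of _ a]
          exI[of _ "b + \<rho> y z"]) auto
  qed
qed simp

text \<open>The classical construction: weigh a pair by \<open>2\<^sup>-\<^sup>k\<close> for the finest entourage that
  contains it, and let the distance be the infimum of the costs of chains.  A chain of cost less
  than \<open>2\<^sup>-\<^sup>k\<close> splits into two chains of at most half the cost and one edge between them, so by
  induction it stays within three steps of size \<open>G\<^sub>k\<^sub>+\<^sub>1\<close>, that is, within \<open>G\<^sub>k\<close>.\<close>

lemma metric_from_entourages: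
  fixes G :: "nat \<Rightarrow> 'a \<Rightarrow> 'a \<Rightarrow> bool"
  assumes G0: "\<And>x y. G 0 x y" and refl: "\<And>k x. G k x x" and sym: "\<And>k x y. G k x y \<Longrightarrow> G k y x"
    and three: "\<And>k x u v y. G (Suc k) x u \<Longrightarrow> G (Suc k) u v \<Longrightarrow> G (Suc k) v y \<Longrightarrow> G k x y"
    and sep: "\<And>x y. (\<And>k. G k x y) \<Longrightarrow> x = y"
  shows "\<exists>d. Metric_space UNIV d \<and> (\<forall>k x y. G k x y \<longrightarrow> d x y \<le> (1/2) ^ k) \<and>
    (\<forall>k x y. d x y < (1/2) ^ k \<longrightarrow> G k x y)"
proof -
  define \<rho> where "\<rho> = gauge G"
  have mono: "G k x y" if "G j x y" "k \<le> j" for j k x y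
    using that(2,1) by (induction rule: dec_induct) (use three refl in blast)+
  have bdd: "bdd_below {(1/2::real) ^ k |k. G k x y}" for x y
    by (rule bdd_belowI[of _ 0]) auto
  have ne: "{(1/2::real) ^ k |k. G k x y} \<noteq> {}" for x y
    using G0 by blast
  have \<rho>_nonneg: "0 \<le> \<rho> x y" for x y
    unfolding \<rho>_def gauge_def by (rule cInf_greatest[OF ne]) auto
  have \<rho>_le: "\<rho> x y \<le> (1/2) ^ k" if "G k x y" for k x y
    unfolding \<rho>_def gauge_def by (rule cInf_lower[OF _ bdd]) (use that in auto)
  have \<rho>_less: "G (Suc k) x y" if "\<rho> x y < (1/2) ^ k" for k x y
  proof -
    obtain j where j: "G j x y" "(1/2::real) ^ j < (1/2) ^ k"
      using \<open>\<rho> x y < (1/2) ^ k\<close> unfolding \<rho>_def gauge_def cInf_less_iff[OF ne bdd] by auto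
    then have "\<not> j \<le> k"
      using power_decreasing[of j k "1/2::real"] by auto
    then have "Suc k \<le> j"
      by simp
    then show ?thesis
      using mono j by blast
  qed
  have \<rho>_sym: "\<rho> x y = \<rho> y x" for x y
  proof -
    have "G k x y \<longleftrightarrow> G k y x" for k
      using sym by blast
    then show ?thesis
      unfolding \<rho>_def gauge_def by simp
  qed
  have cost_nonneg: "0 \<le> c" if "chain \<rho> n x y c" for n x y c
    by (rule chain_nonneg[OF that \<rho>_nonneg])
  have chain_G: "G k x y" if "chain \<rho> n x y c" "c < (1/2) ^ k" for n k x y c
    using that
  proof (induction n arbitrary: k x y c rule: less_induct)
    case (less n)
    show ?case
    proof (cases "n = 0")
      case True
      then have "x = y"
        using less.prems(1) by (auto elim: chain.cases)
      then show ?thesis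
        using refl by simp
    next
      case False
      have c0: "0 \<le> c"
        by (rule cost_nonneg[OF less.prems(1)])
      obtain m l u v a b where s: "m < n" "l < n" "chain \<rho> m x u a"
        "chain \<rho> l v y b" "a \<le> c / 2" "b \<le> max 0 (c - c / 2)" "a + \<rho> u v + b = c"
        using chain_split[of \<rho> "c / 2", OF \<rho>_nonneg _ less.prems(1)] False c0 by auto
      have "0 \<le> a" "0 \<le> b"
        using cost_nonneg s(3,4) by blast+
      then have "a < (1/2) ^ Suc k" "b < (1/2) ^ Suc k" "\<rho> u v < (1/2) ^ k"
        using s(5-7) c0 less.prems(2) by auto
      then show ?thesis
        using three less.IH s \<rho>_less by blast
    qed
  qed
  define d where "d x y = Inf {c. \<exists>n. chain \<rho> n x y c}" for x y
  have cbdd: "bdd_below {c. \<exists>n. chain \<rho> n x y c}" for x y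
    by (rule bdd_belowI[of _ 0]) (use cost_nonneg in blast)
  have cne: "{c. \<exists>n. chain \<rho> n x y c} \<noteq> {}" for x y
    using chain_single[of \<rho> x y] by (simp add: set_eq_iff) blast
  have d_le: "d x y \<le> c" if "chain \<rho> n x y c" for n x y c
    unfolding d_def by (rule cInf_lower[OF _ cbdd]) (use that in auto)
  have d_less: "\<exists>n c. chain \<rho> n x y c \<and> c < e" if "d x y < e" for x y e
    using that unfolding d_def cInf_less_iff[OF cne cbdd] by blast
  have d_nonneg: "0 \<le> d x y" for x y
    unfolding d_def by (rule cInf_greatest[OF cne]) (use cost_nonneg in blast)
  have d_small: "G k x y" if "d x y < (1/2) ^ k" for k x y
    using d_less[OF that] chain_G by blast
  have "Metric_space UNIV d"
  proof
    fix x y z :: 'a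
    show "0 \<le> d x y" by (rule d_nonneg)
    have "chain \<rho> n x y c \<longleftrightarrow> chain \<rho> n y x c" for n c
      using chain_reverse \<rho>_sym by metis
    then show "d x y = d y x"
      unfolding d_def by simp
    show "d x y = 0 \<longleftrightarrow> x = y"
    proof
      assume "d x y = 0"
      then have "G k x y" for k
        by (intro d_small) simp
      then show "x = y"
        by (rule sep)
    next
      assume "x = y"
      then show "d x y = 0"
        using d_le[OF chain.stop] d_nonneg[of x y] by (simp add: antisym)
    qed
    show "d x z \<le> d x y + d y z"
    proof (rule field_le_epsilon)
      fix e :: real assume "0 < e"
      then obtain n a m b where "chain \<rho> n x y a" "a < d x y + e / 2" "chain \<rho> m y z b" "b < d y z + e / 2"
        using d_less[of x y "d x y + e / 2"] d_less[of y z "d y z + e / 2"] by auto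
      then show "d x z \<le> d x y + d y z + e"
        using d_le[OF chain_append[of \<rho> m y z b n x a]] by simp
    qed
  qed
  moreover have "d x y \<le> (1/2) ^ k" if "G k x y" for k x y
    using d_le[OF chain_single] \<rho>_le[OF that] order_trans by blast
  ultimately show ?thesis
    using d_small by blast
qed

section \<open>Locally uniform filters of covers\<close>

locale uniform_cover_filter =
  fixes X :: "'b topology" and P :: "'b set set" and \<Theta> :: "'b set set set"
  assumes basis: "is_basis_of X P"
    and covers: "\<Theta> \<subseteq> covers_of X P"
    and cover_filter: "refinement_filter P (\<subseteq>) \<Theta>"
    and locally_uniform: "locally_uniform X \<Theta>"
    and compatible: "compatible_family X \<Theta>"

sublocale uniform_cover_filter \<subseteq> refinement_poset P "(\<subseteq>)" \<Theta>
proof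
  show "poset P (\<subseteq>)"
    unfolding poset_def reflp_on_def antisymp_on_def transp_on_def by blast
qed (rule cover_filter)

context uniform_cover_filter
begin

notation below (infix \<open>\<lhd>\<close> 50)

abbreviation star where
  "star C x \<equiv> \<Union>(members_at C x)"

lemma in_star_iff: "y \<in> star C x \<longleftrightarrow> (\<exists>c\<in>C. x \<in> c \<and> y \<in> c)"
  unfolding members_at_def by blast

lemma openin_P: "p \<in> P \<Longrightarrow> openin X p"
  by (rule is_basis_of_openin[OF basis])

lemma P_subset: "p \<in> P \<Longrightarrow> p \<subseteq> topspace X"
  by (rule openin_subset[OF openin_P])

lemma in_member: "C \<in> \<Theta> \<Longrightarrow> x \<in> topspace X \<Longrightarrow> \<exists>c\<in>C. x \<in> c"
  using covers unfolding covers_of_def by blast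

lemma ex_basic:
  assumes "openin X W" "x \<in> W"
  shows "\<exists>p\<in>P. x \<in> p \<and> p \<subseteq> W"
  using assms openin_iff_basis[OF basis] by blast

lemma small_star:
  assumes "p \<in> P" "x \<in> p"
  shows "\<exists>C\<in>\<Theta>. star C x \<subseteq> p"
proof -
  have "nbhd_of X x p"
    unfolding nbhd_of_def using assms openin_P P_subset by blast
  then show ?thesis
    using compatible assms P_subset unfolding compatible_family_def by blast
qed

lemma star_of_star:
  assumes "x \<in> topspace X" "C \<in> \<Theta>"
  shows "\<exists>D\<in>\<Theta>. \<forall>d\<in>D. d \<inter> star D x \<noteq> {} \<longrightarrow> d \<subseteq> star C x"
proof -
  obtain D where "D \<in> \<Theta>" "\<Union>(members_meeting D (star D x)) \<subseteq> star C x"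
    using locally_uniform assms unfolding locally_uniform_def by blast
  then show ?thesis
    unfolding members_meeting_def by blast
qed

text \<open>Nearness is meeting.  For a common point \<open>x\<close>, the basic sets that miss \<open>x\<close> form no cover,
  but adding a neighbourhood of \<open>x\<close> yields a member of \<open>\<Theta>\<close> by compatibility.\<close>

lemma near_if_common_point:
  assumes "x \<in> topspace X" "S \<subseteq> members_at P x"
  shows "near P (\<subseteq>) \<Theta> S"
proof -
  define D where "D = {p \<in> P. x \<notin> p}"
  have D: "D \<subseteq> P" "D \<notin> \<Theta>"
    using in_member assms(1) unfolding D_def by blast+
  have "insert s D \<in> \<Theta>" if s: "s \<in> S" for s
  proof -
    have sP: "s \<in> P" "x \<in> s"
      using s assms(2) unfolding members_at_def by blast+
    then obtain C where C: "C \<in> \<Theta>" "star C x \<subseteq> s"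
      using small_star by blast
    have "refines (\<subseteq>) C (insert s D)"
      unfolding refines_def
    proof
      fix c assume c: "c \<in> C"
      show "\<exists>d\<in>insert s D. c \<subseteq> d"
      proof (cases "x \<in> c")
        case True
        then show ?thesis
          using C(2) c unfolding members_at_def by blast
      next
        case False
        then show ?thesis
          using c member_subset[OF C(1)] unfolding D_def by blast
      qed
    qed
    then show ?thesis
      using refinement_closed[OF C(1)] D(1) sP(1) by simp
  qed
  moreover have "S \<subseteq> P"
    using assms(2) unfolding members_at_def by blast
  ultimately show ?thesis
    unfolding near_iff using D by blast
qed

text \<open>Conversely, if \<open>D \<union> {p}\<close> and \<open>D \<union> {q}\<close> are in \<open>\<Theta>\<close> for disjoint \<open>p\<close> and \<open>q\<close>, then
  the nonempty members of a common refinement already refine \<open>D\<close>.  Some point is required, as the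
  empty set is near in the empty space when \<open>{\<emptyset>}\<close> but not \<open>\<emptyset>\<close> is a member of \<open>\<Theta>\<close>.\<close>

lemma meet_if_touches:
  assumes x: "x \<in> topspace X" and pq: "touches p q"
  shows "p \<inter> q \<noteq> {}"
proof
  assume disj: "p \<inter> q = {}"
  obtain D where D: "D \<subseteq> P" "D \<notin> \<Theta>" "insert p D \<in> \<Theta>" "insert q D \<in> \<Theta>"
    using pq unfolding near_iff by blast
  obtain C where C: "C \<in> \<Theta>" "refines (\<subseteq>) C (insert p D)" "refines (\<subseteq>) C (insert q D)"
    using common_refinement[OF D(3,4)] by blast
  have "D \<noteq> {}"
    using in_member[OF D(3) x] in_member[OF D(4) x] disj by blast
  have "refines (\<subseteq>) C D"
    unfolding refines_def
  proof
    fix c assume c: "c \<in> C"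
    obtain a b where ab: "a \<in> insert p D" "c \<subseteq> a" "b \<in> insert q D" "c \<subseteq> b"
      using C(2,3) c unfolding refines_def by meson
    show "\<exists>d\<in>D. c \<subseteq> d"
    proof (cases "a \<in> D \<or> b \<in> D")
      case False
      then have "c = {}"
        using ab disj by blast
      then show ?thesis
        using \<open>D \<noteq> {}\<close> by blast
    qed (use ab in blast)
  qed
  then show False
    using refinement_closed[OF C(1) D(1)] D(2) by blast
qed

text \<open>A member of a witnessing family through a point of \<open>q\<close> touches \<open>q\<close>, so it carries this
  point into \<open>p\<close>.\<close>

lemma below_subset:
  assumes "q \<lhd> p"
  shows "q \<subseteq> p"
proof
  fix x assume x: "x \<in> q"
  have q: "q \<in> P" and xX: "x \<in> topspace X"
    using below_in[OF assms] P_subset x by blast+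
  obtain C where C: "C \<in> \<Theta>" "\<forall>c\<in>C. touches c q \<longrightarrow> c \<subseteq> p"
    using assms unfolding below_iff by blast
  obtain c where c: "c \<in> C" "x \<in> c"
    using in_member[OF C(1) xX] by blast
  have "{c, q} \<subseteq> members_at P x"
    using c q x member_subset[OF C(1)] unfolding members_at_def by blast
  then have "touches c q"
    by (rule near_if_common_point[OF xX])
  then show "x \<in> p"
    using C c by blast
qed

text \<open>Local uniformity is what provides sets uniformly inside a given one: any member through
  \<open>x\<close> of a family whose double star at \<open>x\<close> lies in \<open>p\<close> will do.\<close>

lemma ex_below:
  assumes p: "p \<in> P" and x: "x \<in> p"
  shows "\<exists>q. q \<lhd> p \<and> x \<in> q"
proof -
  have xX: "x \<in> topspace X"
    using P_subset p x by blast
  obtain C where C: "C \<in> \<Theta>" "star C x \<subseteq> p"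
    using small_star[OF assms] by metis
  obtain D where D: "D \<in> \<Theta>" "\<forall>d\<in>D. d \<inter> star D x \<noteq> {} \<longrightarrow> d \<subseteq> star C x"
    using star_of_star[OF xX C(1)] by metis
  obtain q where q: "q \<in> D" "x \<in> q"
    using in_member[OF D(1) xX] by blast
  have "q \<subseteq> star D x"
    using q unfolding members_at_def by blast
  then have "d \<subseteq> p" if "d \<in> D" "touches d q" for d
    using meet_if_touches[OF xX that(2)] D(2) C(2) that(1) by blast
  then have "q \<lhd> p"
    unfolding below_iff using D(1) q member_subset p by blast
  then show ?thesis
    using q by blast
qed

lemma admissible: "admissible P (\<subseteq>) \<Theta>"
  unfolding admissible_def is_supremum_def
proof (intro ballI conjI impI)
  fix p u assume "p \<in> P" "u \<in> P" "\<forall>q\<in>{q \<in> P. q \<lhd> p}. q \<subseteq> u"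
  then show "p \<subseteq> u"
    using ex_below below_in by blast
qed (use below_subset in blast)+

sublocale admissible_filter P "(\<subseteq>)" \<Theta>
  by unfold_locales (rule admissible)

text \<open>The neighbourhoods of a point form a point of the spectrum.  Completeness supplies the
  converse: a Cauchy \<open>\<lhd>\<close>-filter contains all neighbourhoods of some point, and if it consists
  of near elements, roundness forces each of them to contain this point.\<close>

lemma members_at_near: "x \<in> topspace X \<Longrightarrow> members_at P x \<subseteq> near_elements P (\<subseteq>) \<Theta>"
  using near_if_common_point[of x "{_}"] by (auto simp: near_elements_def members_at_def)

lemma members_at_cauchy: "x \<in> topspace X \<Longrightarrow> set_cauchy \<Theta> (members_at P x)"
  using in_member member_subset unfolding set_cauchy_def members_at_def by blast

lemma members_at_filter:
  assumes x: "x \<in> topspace X"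
  shows "unif_below_filter P (\<subseteq>) \<Theta> (members_at P x)"
  unfolding unif_below_filter_def
proof (intro conjI ballI allI impI)
  show "members_at P x \<subseteq> P"
    unfolding members_at_def by blast
  show "p \<in> members_at P x" if "r \<in> members_at P x" "p \<in> P" "r \<lhd> p" for r p
    using that below_subset unfolding members_at_def by blast
next
  fix F assume F: "finite F \<and> F \<subseteq> members_at P x"
  have "openin X (topspace X \<inter> \<Inter>F)"
  proof (cases "F = {}")
    case False
    have "openin X (\<Inter>F)"
      using F False openin_P unfolding members_at_def by (intro openin_Inter) auto
    then show ?thesis
      by blast
  qed simp
  moreover have "x \<in> topspace X \<inter> \<Inter>F"
    using F x unfolding members_at_def by blast
  ultimately obtain p where p: "p \<in> P" "x \<in> p" "p \<subseteq> topspace X \<inter> \<Inter>F"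
    using ex_basic by blast
  obtain q where q: "q \<lhd> p" "x \<in> q"
    using ex_below p by blast
  have "q \<lhd> f" if "f \<in> F" for f
    using below_trans_le[OF subset_refl q(1), of f] p(3) F that below_in[OF q(1)]
    unfolding members_at_def by blast
  then show "\<exists>s\<in>members_at P x. \<forall>f\<in>F. s \<lhd> f"
    using q below_in unfolding members_at_def by blast
qed

lemma filter_eq_members_at:
  assumes "complete_family X P \<Theta>" and R: "R \<subseteq> near_elements P (\<subseteq>) \<Theta>" "set_cauchy \<Theta> R"
    "unif_below_filter P (\<subseteq>) \<Theta> R"
  shows "\<exists>x\<in>topspace X. R = members_at P x"
proof -
  obtain x where x: "x \<in> topspace X" "members_at P x \<subseteq> R"
    using assms filter_subset[OF R(3)] unfolding complete_family_def by blast
  have "r \<in> members_at P x" if r: "r \<in> R" for r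
  proof -
    obtain C where C: "C \<in> \<Theta>" "\<And>c. c \<in> C \<Longrightarrow> c \<in> R \<Longrightarrow> c \<subseteq> r"
      using filter_round[OF R(3,1) r] by blast
    obtain c where "c \<in> C" "x \<in> c"
      using in_member[OF C(1) x(1)] by blast
    then show ?thesis
      using C x(2) r member_subset[OF C(1)] filter_subset[OF R(3)] unfolding members_at_def by blast
  qed
  then show ?thesis
    using x by blast
qed

lemma cauchy_filters_eq_points:
  assumes "complete_family X P \<Theta>"
  shows "{R. R \<subseteq> near_elements P (\<subseteq>) \<Theta> \<and> set_cauchy \<Theta> R \<and> unif_below_filter P (\<subseteq>) \<Theta> R} =
    {members_at P x | x. x \<in> topspace X}"
proof (intro set_eqI iffI)
  fix R assume "R \<in> {R. R \<subseteq> near_elements P (\<subseteq>) \<Theta> \<and> set_cauchy \<Theta> R \<and> unif_below_filter P (\<subseteq>) \<Theta> R}"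
  then show "R \<in> {members_at P x | x. x \<in> topspace X}"
    using filter_eq_members_at[OF assms] by simp blast
next
  fix R assume "R \<in> {members_at P x | x. x \<in> topspace X}"
  then show "R \<in> {R. R \<subseteq> near_elements P (\<subseteq>) \<Theta> \<and> set_cauchy \<Theta> R \<and> unif_below_filter P (\<subseteq>) \<Theta> R}"
    using members_at_near members_at_cauchy members_at_filter by force
qed

text \<open>The bijection \<open>x \<mapsto> P\<^sub>x\<close> matches the basis \<open>P\<close> with the basis of the spectrum.\<close>

lemma spectrum_homeomorphic:
  assumes t0: "t0_space X" and complete: "complete_family X P \<Theta>"
  shows "Y homeomorphic_space X"
proof -
  let ?f = "members_at P"
  have spec: "spectrum P (\<subseteq>) regular = ?f ` topspace X"
    unfolding spectrum_eq cauchy_filters_eq_points[OF complete] by blast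
  have inj: "inj_on ?f (topspace X)"
  proof (rule inj_onI)
    fix x y assume "x \<in> topspace X" "y \<in> topspace X" and eq: "?f x = ?f y"
    moreover have "x \<in> p \<longleftrightarrow> y \<in> p" if "p \<in> P" for p
      using eq that unfolding members_at_def by blast
    ultimately show "x = y"
      using t0_space_basis_eq[OF t0 basis] by blast
  qed
  have f_in: "?f x \<in> U p \<longleftrightarrow> x \<in> p" if "x \<in> topspace X" "p \<in> P" for x p
    using that unfolding spectrum_open_def spec members_at_def by blast
  have "homeomorphic_map X Y ?f"
  proof (rule bijective_open_imp_homeomorphic_map)
    show "continuous_map X Y ?f"
      unfolding continuous_map_def
    proof (intro conjI allI impI)
      show "?f \<in> topspace X \<rightarrow> topspace Y"
        using spec by simp
      fix W assume W: "openin Y W"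
      show "openin X {x \<in> topspace X. ?f x \<in> W}"
        unfolding openin_iff_basis[OF basis]
      proof
        fix x assume x: "x \<in> {x \<in> topspace X. ?f x \<in> W}"
        then obtain p where p: "p \<in> P" "?f x \<in> U p" "U p \<subseteq> W"
          using W openin_iff_basis[OF spectrum_basis] by blast
        then show "\<exists>p\<in>P. x \<in> p \<and> p \<subseteq> {x \<in> topspace X. ?f x \<in> W}"
          using f_in x P_subset[OF p(1)] by blast
      qed
    qed
    show "open_map X Y ?f"
      unfolding open_map_def
    proof (intro allI impI)
      fix W assume W: "openin X W"
      show "openin Y (?f ` W)"
        unfolding openin_iff_basis[OF spectrum_basis]
      proof
        fix R assume "R \<in> ?f ` W"
        then obtain x where x: "x \<in> W" "R = ?f x" by blast
        then obtain p where p: "p \<in> P" "x \<in> p" "p \<subseteq> W"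
          using ex_basic W by blast
        have "x \<in> topspace X"
          using openin_subset[OF W] x by blast
        then have "R \<in> U p"
          using f_in p x by blast
        moreover have "U p \<subseteq> ?f ` W"
        proof
          fix S assume S: "S \<in> U p"
          then obtain y where "y \<in> topspace X" "S = ?f y"
            using spec unfolding spectrum_open_def by blast
          then show "S \<in> ?f ` W"
            using S f_in p by blast
        qed
        ultimately show "\<exists>b\<in>U ` P. R \<in> b \<and> b \<subseteq> ?f ` W"
          using p by blast
      qed
    qed
  qed (use spec inj in simp_all)
  then show ?thesis
    using homeomorphic_map_imp_homeomorphic_space homeomorphic_space_sym by blast
qed

end

section \<open>Complete metrisability\<close>

text \<open>The sets \<open>W k x\<close> play the part of balls around \<open>x\<close> in a uniformity on \<open>X\<close>, and the sets
  \<open>B k\<close> form a base of \<open>\<Theta>\<close>.  Any two meeting balls of size \<open>k + 1\<close> are contained in one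
  of size \<open>k\<close> around one of their centres, and the balls of size \<open>k + 1\<close> through a point \<open>y\<close> are
  all contained in a single ball of size \<open>k\<close>.  The last condition links metric completeness to
  the completeness of \<open>\<Theta>\<close>: a ball of size \<open>k + 1\<close> is covered by a basic set that is uniformly
  below a subset of both the concentric ball of size \<open>k\<close> and a member of \<open>B k\<close>.\<close>

locale ball_system = uniform_cover_filter X P \<Theta>
  for X :: "'b topology" and P :: "'b set set" and \<Theta> :: "'b set set set" +
  fixes B :: "nat \<Rightarrow> 'b set set" and W :: "nat \<Rightarrow> 'b \<Rightarrow> 'b set"
  assumes B_base: "C \<in> \<Theta> \<Longrightarrow> \<exists>n. refines (\<subseteq>) (B n) C"
    and B_mem: "B n \<in> \<Theta>"
    and W_open: "x \<in> topspace X \<Longrightarrow> openin X (W k x)"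
    and W_self: "x \<in> topspace X \<Longrightarrow> x \<in> W k x"
    and W_nest: "x \<in> topspace X \<Longrightarrow> W (Suc k) x \<subseteq> W k x"
    and W_union: "x \<in> topspace X \<Longrightarrow> y \<in> topspace X \<Longrightarrow> W (Suc k) x \<inter> W (Suc k) y \<noteq> {} \<Longrightarrow>
      W (Suc k) x \<subseteq> W k y \<or> W (Suc k) y \<subseteq> W k x"
    and W_star: "y \<in> topspace X \<Longrightarrow>
      \<exists>x\<in>topspace X. y \<in> W k x \<and> (\<forall>z\<in>topspace X. y \<in> W (Suc k) z \<longrightarrow> W (Suc k) z \<subseteq> W k x)"
    and W_base: "p \<in> P \<Longrightarrow> y \<in> p \<Longrightarrow> \<exists>k. \<forall>x\<in>topspace X. y \<in> W k x \<longrightarrow> W k x \<subseteq> p"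
    and W_inside: "x \<in> topspace X \<Longrightarrow>
      \<exists>q p. q \<lhd> p \<and> p \<subseteq> W k x \<and> W (Suc k) x \<subseteq> q \<and> (\<exists>b\<in>B k. p \<subseteq> b)"
begin

text \<open>The entourages of the uniformity.\<close>

definition close where
  "close k y z \<longleftrightarrow> (\<exists>x\<in>topspace X. y \<in> W k x \<and> z \<in> W k x)"

lemma W_subset: "x \<in> topspace X \<Longrightarrow> W k x \<subseteq> topspace X"
  by (rule openin_subset[OF W_open])

lemma close_in: "close k y z \<Longrightarrow> y \<in> topspace X \<and> z \<in> topspace X"
  unfolding close_def using W_subset by blast

lemma close_refl: "y \<in> topspace X \<Longrightarrow> close k y y"
  unfolding close_def using W_self by blast

lemma close_sym: "close k y z \<Longrightarrow> close k z y"
  unfolding close_def by blast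

lemma close_Suc: "close (Suc k) y z \<Longrightarrow> close k y z"
  unfolding close_def using W_nest by blast

lemma close_mono: "close j y z \<Longrightarrow> k \<le> j \<Longrightarrow> close k y z"
  by (induction j) (auto simp: le_Suc_eq dest: close_Suc)

lemma close_trans:
  assumes "close (Suc k) x y" "close (Suc k) y z"
  shows "close k x z"
proof -
  obtain a where a: "a \<in> topspace X" "x \<in> W (Suc k) a" "y \<in> W (Suc k) a"
    using assms(1) unfolding close_def by blast
  obtain b where b: "b \<in> topspace X" "y \<in> W (Suc k) b" "z \<in> W (Suc k) b"
    using assms(2) unfolding close_def by blast
  have "W (Suc k) a \<subseteq> W k b \<or> W (Suc k) b \<subseteq> W k a"
    using W_union[OF a(1) b(1)] a(3) b(2) by blast
  then show ?thesis
    using a b W_nest[of a k] W_nest[of b k] unfolding close_def by blast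
qed

lemma close_star:
  assumes "y \<in> topspace X"
  shows "\<exists>x\<in>topspace X. y \<in> W k x \<and> (\<forall>z. close (Suc k) y z \<longrightarrow> z \<in> W k x)"
proof -
  obtain x where x: "x \<in> topspace X" "y \<in> W k x"
    "\<And>z. z \<in> topspace X \<Longrightarrow> y \<in> W (Suc k) z \<Longrightarrow> W (Suc k) z \<subseteq> W k x"
    using W_star[OF assms, of k] by metis
  have "z \<in> W k x" if "close (Suc k) y z" for z
    using that x(3) unfolding close_def by blast
  then show ?thesis
    using x by blast
qed

lemma close_base:
  assumes "p \<in> P" "y \<in> p"
  shows "\<exists>k. \<forall>z. close k y z \<longrightarrow> z \<in> p"
proof -
  obtain k where k: "\<And>x. x \<in> topspace X \<Longrightarrow> y \<in> W k x \<Longrightarrow> W k x \<subseteq> p"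
    using W_base[OF assms] by metis
  have "z \<in> p" if "close k y z" for z
    using that k unfolding close_def by blast
  then show ?thesis
    by blast
qed

text \<open>Every second entourage satisfies the three-step condition of the metrisation lemma.\<close>

lemma ex_metric:
  assumes t0: "t0_space X"
  shows "\<exists>d. Metric_space (topspace X) d \<and>
    (\<forall>k. \<exists>e>0. \<forall>x\<in>topspace X. \<forall>y\<in>topspace X. d x y < e \<longrightarrow> close k x y) \<and>
    (\<forall>e>0. \<exists>k. \<forall>x y. close k x y \<longrightarrow> d x y < e)"
proof -
  define G where "G k x y \<longleftrightarrow> k = 0 \<or> x = y \<or> close (2 * k) x y" for k :: nat and x y
  have trans: "x = z \<or> close k x z"
    if "x = y \<or> close (Suc k) x y" "y = z \<or> close (Suc k) y z" for k x y z
    using that close_trans close_Suc by blast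
  have "\<exists>d. Metric_space UNIV d \<and> (\<forall>k x y. G k x y \<longrightarrow> d x y \<le> (1/2) ^ k) \<and>
    (\<forall>k x y. d x y < (1/2) ^ k \<longrightarrow> G k x y)"
  proof (rule metric_from_entourages)
    show "G 0 x y" "G k x x" for k x y
      unfolding G_def by simp_all
    show "G k y x" if "G k x y" for k x y
      using that close_sym unfolding G_def by blast
    show "G k x y" if "G (Suc k) x u" "G (Suc k) u v" "G (Suc k) v y" for k x u v y
    proof -
      have s: "a = b \<or> close (Suc (Suc (2 * k))) a b" if "G (Suc k) a b" for a b
        using that unfolding G_def by simp
      have "x = v \<or> close (Suc (2 * k)) x v"
        by (rule trans[OF s[OF that(1)] s[OF that(2)]])
      moreover have "v = y \<or> close (Suc (2 * k)) v y"
        using s[OF that(3)] close_Suc by blast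
      ultimately have "x = y \<or> close (2 * k) x y"
        by (rule trans)
      then show ?thesis
        unfolding G_def by blast
    qed
    show "x = y" if G: "\<And>k. G k x y" for x y
    proof (rule ccontr)
      assume ne: "x \<noteq> y"
      have close: "close k x y" for k
        using G[of "Suc k"] ne close_mono[of "2 * Suc k" x y k] unfolding G_def by simp
      have "x \<in> p \<longleftrightarrow> y \<in> p" if "p \<in> P" for p
        using close_base[OF that] close close_sym by blast
      then show False
        using t0_space_basis_eq[OF t0 basis] close_in[OF close] ne by blast
    qed
  qed
  then obtain d where d: "Metric_space UNIV d" "\<And>k x y. G k x y \<Longrightarrow> d x y \<le> (1/2) ^ k"
    "\<And>k x y. d x y < (1/2) ^ k \<Longrightarrow> G k x y"
    by blast
  have "close k x y" if "x \<in> topspace X" "d x y < (1/2) ^ Suc k" for k x y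
    using d(3)[OF that(2)] close_refl[OF that(1)] close_mono[of "2 * Suc k" x y k]
    unfolding G_def by auto
  then have "\<exists>e>0. \<forall>x\<in>topspace X. \<forall>y\<in>topspace X. d x y < e \<longrightarrow> close k x y" for k
    by (intro exI[of _ "(1/2) ^ Suc k"]) auto
  moreover have "\<exists>k. \<forall>x y. close k x y \<longrightarrow> d x y < e" if e: "e > 0" for e :: real
  proof -
    obtain k where k: "(1/2::real) ^ k < e"
      using real_arch_pow_inv[OF e, of "1/2"] by auto
    have "d x y < e" if "close (2 * k) x y" for x y
      using d(2)[of k x y] that k unfolding G_def by fastforce
    then show ?thesis
      by blast
  qed
  moreover have "Metric_space (topspace X) d"
    using Metric_space.subspace[OF d(1)] by simp
  ultimately show ?thesis
    by blast
qed

text \<open>Given a sequence that is Cauchy for the entourages, the basic sets that eventually contain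
  a ball of fixed size around its terms form a \<open>\<lhd>\<close>-filter.  The key is that around a late term
  there are balls \<open>W (k + 1) x \<subseteq> q\<close> with \<open>q \<lhd> p \<subseteq> W k x\<close>, where \<open>q\<close> still belongs to the
  filter and \<open>p\<close> is as small as desired.\<close>

lemma cauchy_converges:
  assumes complete: "complete_family X P \<Theta>"
    and \<sigma>: "\<And>n. \<sigma> n \<in> topspace X" "\<And>k. \<exists>N. \<forall>n\<ge>N. \<forall>m\<ge>N. close k (\<sigma> n) (\<sigma> m)"
  shows "\<exists>x. limitin X \<sigma> x sequentially"
proof -
  define thick where "thick S k N \<longleftrightarrow> (\<forall>n\<ge>N. \<forall>z. close k (\<sigma> n) z \<longrightarrow> z \<in> S)" for S k N
  define R where "R = {p \<in> P. \<exists>k N. thick p k N}"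
  have thick_mono: "thick S k' N'" if "thick S k N" "k \<le> k'" "N \<le> N'" for S k N k' N'
    using that close_mono unfolding thick_def by (meson order_trans)
  have key: "\<exists>q\<in>R. \<exists>p b. q \<lhd> p \<and> p \<subseteq> S \<and> b \<in> B k \<and> p \<subseteq> b" if S: "thick S k N" for S k N
  proof -
    obtain N' where N': "\<forall>n\<ge>N'. \<forall>m\<ge>N'. close (Suc (Suc (Suc k))) (\<sigma> n) (\<sigma> m)"
      using \<sigma>(2) by blast
    define M where "M = max N N'"
    obtain x where x: "x \<in> topspace X" "\<sigma> M \<in> W (Suc k) x"
      "\<And>z. close (Suc (Suc k)) (\<sigma> M) z \<Longrightarrow> z \<in> W (Suc k) x"
      using close_star[OF \<sigma>(1)[of M], of "Suc k"] by metis
    obtain q p b where q: "q \<lhd> p" "p \<subseteq> W k x" "W (Suc k) x \<subseteq> q" "b \<in> B k" "p \<subseteq> b"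
      using W_inside[OF x(1), of k] by metis
    have "thick q (Suc (Suc (Suc k))) M"
      unfolding thick_def
    proof (intro allI impI)
      fix n z assume "M \<le> n" and z: "close (Suc (Suc (Suc k))) (\<sigma> n) z"
      then have "close (Suc (Suc (Suc k))) (\<sigma> M) (\<sigma> n)"
        using N' unfolding M_def by simp
      then have "close (Suc (Suc k)) (\<sigma> M) z"
        using z by (rule close_trans)
      then show "z \<in> q"
        using x(3) q(3) by blast
    qed
    then have "q \<in> R"
      unfolding R_def using below_in[OF q(1)] by blast
    have "p \<subseteq> S"
    proof
      fix z assume "z \<in> p"
      moreover have "\<sigma> M \<in> W k x"
        using x W_nest by blast
      ultimately have "close k (\<sigma> M) z"
        unfolding close_def using x(1) q(2) by blast
      moreover have "N \<le> M"
        unfolding M_def by simp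
      ultimately show "z \<in> S"
        using S unfolding thick_def by blast
    qed
    then show ?thesis
      using \<open>q \<in> R\<close> q by blast
  qed
  have R_up: "p' \<in> R" if "p \<in> R" "p' \<in> P" "p \<subseteq> p'" for p p'
  proof -
    obtain k N where "thick p k N"
      using \<open>p \<in> R\<close> unfolding R_def by blast
    then have "thick p' k N"
      unfolding thick_def using \<open>p \<subseteq> p'\<close> by blast
    then show ?thesis
      unfolding R_def using \<open>p' \<in> P\<close> by blast
  qed
  have "set_cauchy \<Theta> R"
    unfolding set_cauchy_def
  proof
    fix C assume C: "C \<in> \<Theta>"
    obtain k where k: "refines (\<subseteq>) (B k) C"
      using B_base[OF C] by blast
    have "thick (topspace X) k 0"
      unfolding thick_def using close_in by blast
    then obtain q p b where q: "q \<in> R" "q \<lhd> p" "b \<in> B k" "p \<subseteq> b"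
      using key by metis
    obtain c where "c \<in> C" "b \<subseteq> c"
      using k q(3) unfolding refines_def by blast
    moreover have "q \<subseteq> c"
      using below_subset[OF q(2)] q(4) \<open>b \<subseteq> c\<close> by blast
    ultimately have "c \<in> R"
      using R_up[OF q(1)] member_subset[OF C] by blast
    then show "C \<inter> R \<noteq> {}"
      using \<open>c \<in> C\<close> by blast
  qed
  moreover have "unif_below_filter P (\<subseteq>) \<Theta> R"
    unfolding unif_below_filter_def
  proof (intro conjI ballI allI impI)
    show "R \<subseteq> P"
      unfolding R_def by blast
    show "p \<in> R" if "r \<in> R" "p \<in> P" "r \<lhd> p" for r p
      using R_up[OF that(1,2) below_subset[OF that(3)]] .
  next
    fix F assume F: "finite F \<and> F \<subseteq> R"
    then have "finite F" "F \<subseteq> R"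
      by auto
    then have "\<exists>k N. \<forall>f\<in>F. thick f k N"
    proof (induction F rule: finite_induct)
      case (insert f F)
      then obtain k N where kN: "\<forall>f\<in>F. thick f k N"
        by blast
      obtain k' N' where f: "thick f k' N'"
        using insert.prems unfolding R_def by blast
      have "thick g (max k k') (max N N')" if "g \<in> insert f F" for g
        using that kN thick_mono[OF f, of "max k k'" "max N N'"]
          thick_mono[of g k N "max k k'" "max N N'"] by auto
      then show ?case
        by blast
    qed blast
    then obtain k N where "\<forall>f\<in>F. thick f k N"
      by blast
    then have "thick (\<Inter>F) k N"
      unfolding thick_def by blast
    then obtain q p where q: "q \<in> R" "q \<lhd> p" "p \<subseteq> \<Inter>F"
      using key by metis
    have "q \<lhd> f" if "f \<in> F" for f
    proof -
      have "f \<in> P" "p \<subseteq> f" "q \<in> P"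
        using F that q unfolding R_def by blast+
      then show ?thesis
        using below_trans_le[OF subset_refl q(2)] by blast
    qed
    then show "\<exists>s\<in>R. \<forall>f\<in>F. s \<lhd> f"
      using q(1) by blast
  qed
  ultimately obtain x where x: "x \<in> topspace X" "members_at P x \<subseteq> R"
    using complete filter_subset unfolding complete_family_def by blast
  have "limitin X \<sigma> x sequentially"
    unfolding limitin_def
  proof (intro conjI allI impI)
    fix S assume "openin X S \<and> x \<in> S"
    then obtain p where p: "p \<in> P" "x \<in> p" "p \<subseteq> S"
      using ex_basic by blast
    then have "p \<in> R"
      using x(2) unfolding members_at_def by blast
    then obtain k N where "thick p k N"
      unfolding R_def by blast
    then have "\<sigma> n \<in> S" if "n \<ge> N" for n
      using that close_refl[OF \<sigma>(1)] p(3) unfolding thick_def by blast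
    then show "\<forall>\<^sub>F n in sequentially. \<sigma> n \<in> S"
      unfolding eventually_sequentially by blast
  qed (rule x(1))
  then show ?thesis
    by blast
qed

text \<open>The metric topology is the given one because balls \<open>W k x\<close> are open neighbourhoods and the
  sets of points close to \<open>x\<close> shrink into every basic neighbourhood of \<open>x\<close>.\<close>

theorem metrizable_by_balls:
  assumes "t0_space X" "complete_family X P \<Theta>"
  shows "completely_metrizable_space X"
proof -
  obtain d where d: "Metric_space (topspace X) d"
    "\<And>k. \<exists>e>0. \<forall>x\<in>topspace X. \<forall>y\<in>topspace X. d x y < e \<longrightarrow> close k x y"
    "\<And>e. e > 0 \<Longrightarrow> \<exists>k. \<forall>x y. close k x y \<longrightarrow> d x y < e"
    using ex_metric[OF assms(1)] by blast
  interpret Metric_space "topspace X" d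
    by (rule d(1))
  have "openin mtopology S \<longleftrightarrow> openin X S" for S
  proof
    assume S: "openin mtopology S"
    show "openin X S"
      unfolding openin_subopen[of X S]
    proof
      fix x assume x: "x \<in> S"
      then obtain r where r: "r > 0" "mball x r \<subseteq> S"
        using S unfolding openin_mtopology by blast
      have xX: "x \<in> topspace X"
        using openin_subset[OF S] x by auto
      obtain k where k: "\<And>x y. close k x y \<Longrightarrow> d x y < r"
        using d(3)[OF r(1)] by blast
      have "W k x \<subseteq> mball x r"
      proof
        fix y assume y: "y \<in> W k x"
        then have "close k x y"
          unfolding close_def using xX W_self by blast
        then show "y \<in> mball x r"
          using k close_in by auto
      qed
      then show "\<exists>T. openin X T \<and> x \<in> T \<and> T \<subseteq> S"
        using W_open[OF xX, of k] W_self[OF xX, of k] r(2) by (meson subset_trans)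
    qed
  next
    assume S: "openin X S"
    show "openin mtopology S"
      unfolding openin_mtopology
    proof (intro conjI allI impI)
      fix x assume "x \<in> S"
      then obtain p where p: "p \<in> P" "x \<in> p" "p \<subseteq> S"
        using ex_basic[OF S] by blast
      obtain k where k: "\<forall>z. close k x z \<longrightarrow> z \<in> p"
        using close_base[OF p(1,2)] by blast
      obtain e where e: "e > 0" "\<forall>x\<in>topspace X. \<forall>y\<in>topspace X. d x y < e \<longrightarrow> close k x y"
        using d(2) by blast
      have "mball x e \<subseteq> S"
        using e(2) k p(3) by auto
      then show "\<exists>r>0. mball x r \<subseteq> S"
        using e(1) by blast
    qed (rule openin_subset[OF S])
  qed
  then have top: "X = mtopology"
    by (simp add: topology_eq)
  have "mcomplete"
    unfolding mcomplete_def
  proof (intro allI impI)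
    fix \<sigma> assume \<sigma>: "MCauchy \<sigma>"
    then have in_X: "\<sigma> n \<in> topspace X" for n
      unfolding MCauchy_def by blast
    have "\<exists>N. \<forall>n\<ge>N. \<forall>m\<ge>N. close k (\<sigma> n) (\<sigma> m)" for k
    proof -
      obtain e where e: "e > 0" "\<forall>x\<in>topspace X. \<forall>y\<in>topspace X. d x y < e \<longrightarrow> close k x y"
        using d(2) by blast
      obtain N where "\<forall>n n'. N \<le> n \<longrightarrow> N \<le> n' \<longrightarrow> d (\<sigma> n) (\<sigma> n') < e"
        using \<sigma> e(1) unfolding MCauchy_def by blast
      then show ?thesis
        using e(2) in_X by blast
    qed
    then show "\<exists>x. limitin mtopology \<sigma> x sequentially"
      using cauchy_converges[OF assms(2) in_X] top by simp
  qed
  then show ?thesis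
    unfolding completely_metrizable_space_def using d(1) top by blast
qed

end

context uniform_cover_filter
begin

lemma star_refine:
  assumes "refines (\<subseteq>) D C"
  shows "star D x \<subseteq> star C x"
proof
  fix y assume "y \<in> star D x"
  then obtain d where d: "d \<in> D" "x \<in> d" "y \<in> d"
    unfolding members_at_def by blast
  then obtain c where "c \<in> C" "d \<subseteq> c"
    using assms unfolding refines_def by blast
  then show "y \<in> star C x"
    using d unfolding members_at_def by blast
qed

lemma star_sym: "y \<in> star C x \<longleftrightarrow> x \<in> star C y"
  unfolding in_star_iff by blast

text \<open>Two applications of local uniformity: stars that meet a small star at \<open>x\<close> are contained in
  a given one.\<close>

lemma star_meeting_star:
  assumes x: "x \<in> topspace X" and C: "C \<in> \<Theta>"
  shows "\<exists>D\<in>\<Theta>. \<forall>y. star D x \<inter> star D y \<noteq> {} \<longrightarrow> star D y \<subseteq> star C x"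
proof -
  have two: "\<exists>D\<in>\<Theta>. \<forall>y\<in>star D x. star D y \<subseteq> star A x" if A: "A \<in> \<Theta>" for A
  proof -
    obtain D where D: "D \<in> \<Theta>" "\<forall>d\<in>D. d \<inter> star D x \<noteq> {} \<longrightarrow> d \<subseteq> star A x"
      using star_of_star[OF x A] by metis
    have "star D y \<subseteq> star A x" if y: "y \<in> star D x" for y
    proof
      fix z assume "z \<in> star D y"
      then obtain d where "d \<in> D" "y \<in> d" "z \<in> d"
        unfolding in_star_iff by blast
      then show "z \<in> star A x"
        using D(2) y by blast
    qed
    then show ?thesis
      using D(1) by blast
  qed
  obtain D1 where D1: "D1 \<in> \<Theta>" "\<And>y. y \<in> star D1 x \<Longrightarrow> star D1 y \<subseteq> star C x"
    using two[OF C] by metis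
  obtain D2 where D2: "D2 \<in> \<Theta>" "\<And>y. y \<in> star D2 x \<Longrightarrow> star D2 y \<subseteq> star D1 x"
    using two[OF D1(1)] by metis
  obtain D where D: "D \<in> \<Theta>" "refines (\<subseteq>) D D1" "refines (\<subseteq>) D D2"
    using common_refinement[OF D1(1) D2(1)] by metis
  have "star D y \<subseteq> star C x" if meet: "star D x \<inter> star D y \<noteq> {}" for y
  proof -
    obtain z where z: "z \<in> star D x" "z \<in> star D y"
      using meet by blast
    have "z \<in> star D2 x" "y \<in> star D2 z"
      using z star_sym[of y D z] star_refine[OF D(3)] by blast+
    then have "y \<in> star D1 x"
      using D2(2) by blast
    then show ?thesis
      using D1(2) star_refine[OF D(2), of y] by blast
  qed
  then show ?thesis
    using D(1) by blast
qed

text \<open>Local uniformity is turned into uniformity by letting the radius depend on the point.  Put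
  \<open>V n x = star (B n) x\<close> and \<open>W k x = V (f x k) x\<close>, with \<open>f x (k + 1)\<close> so large that every
  \<open>V m y\<close> meeting \<open>V m x\<close> lies in \<open>W k x\<close> when \<open>m = f x (k + 1)\<close>.  If \<open>W (k + 1) x\<close> meets
  \<open>W (k + 1) y\<close>, then the one whose index is larger lies in the ball \<open>W k\<close> around the centre of
  the other: its index may be lowered, as \<open>V\<close> is decreasing.\<close>

lemma ex_ball_system:
  assumes cf: "countable_filter P (\<subseteq>) \<Theta>"
  shows "\<exists>B W. ball_system X P \<Theta> B W"
proof -
  obtain B where B: "\<And>n. B n \<in> \<Theta>" "\<And>n. refines (\<subseteq>) (B (Suc n)) (B n)"
    "\<And>C. C \<in> \<Theta> \<Longrightarrow> \<exists>n. refines (\<subseteq>) (B n) C"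
    using countable_filter_sequence[OF poset cf] by metis
  define V where "V n x = star (B n) x" for n x
  have V_mono: "V m x \<subseteq> V n x" if "n \<le> m" for m n x
  proof (rule lift_Suc_antimono_le[of "\<lambda>n. V n x", OF _ that])
    show "V (Suc i) x \<subseteq> V i x" for i
      unfolding V_def by (rule star_refine[OF B(2)])
  qed
  have V_self: "x \<in> V n x" if "x \<in> topspace X" for n x
    using in_member[OF B(1) that] unfolding V_def in_star_iff by blast
  have V_open: "openin X (V n x)" for n x
    unfolding V_def members_at_def
    by (rule openin_Union) (use openin_P member_subset[OF B(1)] in blast)
  have V_base: "\<exists>n. V n x \<subseteq> p" if p: "p \<in> P" "x \<in> p" for p x
  proof -
    obtain C where C: "C \<in> \<Theta>" "star C x \<subseteq> p"
      using small_star[OF p] by metis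
    obtain n where "refines (\<subseteq>) (B n) C"
      using B(3)[OF C(1)] by blast
    then have "V n x \<subseteq> p"
      unfolding V_def by (rule subset_trans[OF star_refine C(2)])
    then show ?thesis ..
  qed
  have V_meet: "\<exists>m. \<forall>y. V m x \<inter> V m y \<noteq> {} \<longrightarrow> V m y \<subseteq> V n x" if x: "x \<in> topspace X" for n x
  proof -
    obtain D where D: "D \<in> \<Theta>" "\<And>y. star D x \<inter> star D y \<noteq> {} \<Longrightarrow> star D y \<subseteq> V n x"
      using star_meeting_star[OF x B(1)[of n]] unfolding V_def by metis
    obtain m where m: "refines (\<subseteq>) (B m) D"
      using B(3)[OF D(1)] by blast
    have "V m y \<subseteq> V n x" if "V m x \<inter> V m y \<noteq> {}" for y
    proof -
      have "V m x \<subseteq> star D x" "V m y \<subseteq> star D y"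
        unfolding V_def by (rule star_refine[OF m])+
      then show ?thesis
        using that D(2)[of y] by blast
    qed
    then show ?thesis
      by blast
  qed
  define good where "good x k n m \<longleftrightarrow> n \<le> m \<and> Suc k \<le> m \<and>
    (\<forall>y. V m x \<inter> V m y \<noteq> {} \<longrightarrow> V m y \<subseteq> V n x) \<and>
    (\<exists>q p. q \<lhd> p \<and> p \<subseteq> V n x \<and> V m x \<subseteq> q \<and> (\<exists>b\<in>B k. p \<subseteq> b))" for x k n m
  have ex_good: "\<exists>m. good x k n m" if x: "x \<in> topspace X" for x k n
  proof -
    obtain m1 where m1: "\<And>y. V m1 x \<inter> V m1 y \<noteq> {} \<Longrightarrow> V m1 y \<subseteq> V n x"
      using V_meet[OF x] by metis
    obtain b where b: "b \<in> B k" "x \<in> b"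
      using in_member[OF B(1) x] by blast
    have "openin X (V n x \<inter> b)"
      by (rule openin_Int[OF V_open openin_P]) (use b(1) member_subset[OF B(1)] in blast)
    then obtain p where p: "p \<in> P" "x \<in> p" "p \<subseteq> V n x \<inter> b"
      using ex_basic[of "V n x \<inter> b" x] V_self[OF x, of n] b(2) by blast
    obtain q where q: "q \<lhd> p" "x \<in> q"
      using ex_below[OF p(1,2)] by blast
    obtain m2 where m2: "V m2 x \<subseteq> q"
      using V_base[of q x] q(2) below_in[OF q(1)] by blast
    define m where "m = max (max m1 m2) (max n (Suc k))"
    have m: "m1 \<le> m" "m2 \<le> m" "n \<le> m" "Suc k \<le> m"
      unfolding m_def by auto
    have "V m y \<subseteq> V n x" if "V m x \<inter> V m y \<noteq> {}" for y
      using m1[of y] that V_mono[OF m(1), of x] V_mono[OF m(1), of y] by blast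
    moreover have "V m x \<subseteq> q"
      using V_mono[OF m(2), of x] m2 by blast
    ultimately have "good x k n m"
      unfolding good_def using m(3,4) q(1) p(3) b(1) by blast
    then show ?thesis ..
  qed
  have "\<exists>g. \<forall>k. good x k (g k) (g (Suc k))" if "x \<in> topspace X" for x
    using dependent_nat_choice[of "\<lambda>_ _. True" "\<lambda>k n m. good x k n m"] ex_good[OF that] by auto
  then obtain f where f: "\<And>x k. x \<in> topspace X \<Longrightarrow> good x k (f x k) (f x (Suc k))"
    by metis
  have f_ge: "k \<le> f x k" if "x \<in> topspace X" for x k
  proof (cases k)
    case (Suc j)
    then show ?thesis
      using f[OF that, of j] unfolding good_def by blast
  qed simp
  have f_step: "f x k \<le> f x (Suc k)" if "x \<in> topspace X" for x k
    using f[OF that, of k] unfolding good_def by blast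
  define W where "W k x = V (f x k) x" for k x
  have W_swallow: "W (Suc k) y \<subseteq> W k x"
    if x: "x \<in> topspace X" and fxy: "f x (Suc k) \<le> f y (Suc k)"
      and meet: "V (f x (Suc k)) x \<inter> W (Suc k) y \<noteq> {}" for x y k
  proof -
    have "W (Suc k) y \<subseteq> V (f x (Suc k)) y"
      unfolding W_def by (rule V_mono[OF fxy])
    moreover from this have "V (f x (Suc k)) y \<subseteq> V (f x k) x"
      using meet f[OF x, of k] unfolding good_def by blast
    ultimately show ?thesis
      unfolding W_def by blast
  qed
  have "ball_system X P \<Theta> B W"
  proof
    fix C assume "C \<in> \<Theta>"
    then show "\<exists>n. refines (\<subseteq>) (B n) C"
      by (rule B(3))
  next
    show "B n \<in> \<Theta>" for n
      by (rule B(1))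
  next
    fix x k assume x: "x \<in> topspace X"
    show "openin X (W k x)"
      unfolding W_def by (rule V_open)
    show "x \<in> W k x"
      unfolding W_def by (rule V_self[OF x])
    show "W (Suc k) x \<subseteq> W k x"
      unfolding W_def by (rule V_mono[OF f_step[OF x]])
    show "\<exists>q p. q \<lhd> p \<and> p \<subseteq> W k x \<and> W (Suc k) x \<subseteq> q \<and> (\<exists>b\<in>B k. p \<subseteq> b)"
      using f[OF x, of k] unfolding good_def W_def by blast
  next
    fix x y k
    assume x: "x \<in> topspace X" and y: "y \<in> topspace X" and meet: "W (Suc k) x \<inter> W (Suc k) y \<noteq> {}"
    show "W (Suc k) x \<subseteq> W k y \<or> W (Suc k) y \<subseteq> W k x"
    proof (cases "f x (Suc k) \<le> f y (Suc k)")
      case True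
      then show ?thesis
        using W_swallow[OF x True] meet unfolding W_def by blast
    next
      case False
      then have "f y (Suc k) \<le> f x (Suc k)"
        by simp
      then show ?thesis
        using W_swallow[OF y, of k x] meet unfolding W_def by blast
    qed
  next
    fix y k assume y: "y \<in> topspace X"
    \<comment> \<open>Among the balls \<open>W (k + 1) x\<close> that contain \<open>y\<close>, the one of least index swallows all.\<close>
    define S where "S = {x \<in> topspace X. y \<in> W (Suc k) x}"
    have "y \<in> S"
      unfolding S_def W_def using y V_self by blast
    then obtain x where x: "x \<in> S" "\<And>z. z \<in> S \<Longrightarrow> f x (Suc k) \<le> f z (Suc k)"
      using ex_has_least_nat[of "\<lambda>x. x \<in> S" y "\<lambda>x. f x (Suc k)"] by blast
    then have xX: "x \<in> topspace X" and yx: "y \<in> V (f x (Suc k)) x"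
      unfolding S_def W_def by auto
    have "y \<in> W k x"
      using yx V_mono[OF f_step[OF xX]] unfolding W_def by blast
    moreover have "W (Suc k) z \<subseteq> W k x" if "z \<in> topspace X" "y \<in> W (Suc k) z" for z
    proof (rule W_swallow[OF xX])
      show "f x (Suc k) \<le> f z (Suc k)"
        using x(2) that unfolding S_def by blast
      show "V (f x (Suc k)) x \<inter> W (Suc k) z \<noteq> {}"
        using yx that(2) by blast
    qed
    ultimately show "\<exists>x\<in>topspace X. y \<in> W k x \<and>
        (\<forall>z\<in>topspace X. y \<in> W (Suc k) z \<longrightarrow> W (Suc k) z \<subseteq> W k x)"
      using xX by blast
  next
    fix p y assume p: "p \<in> P" "y \<in> p"
    then have y: "y \<in> topspace X"
      using P_subset by blast
    obtain n where n: "V n y \<subseteq> p"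
      using V_base[OF p] by blast
    obtain m where m: "\<And>x. V m y \<inter> V m x \<noteq> {} \<Longrightarrow> V m x \<subseteq> V n y"
      using V_meet[OF y] by metis
    have "W m x \<subseteq> p" if x: "x \<in> topspace X" "y \<in> W m x" for x
    proof -
      have "W m x \<subseteq> V m x"
        unfolding W_def by (rule V_mono[OF f_ge[OF x(1)]])
      moreover from this have "V m x \<subseteq> V n y"
        using m[of x] V_self[OF y, of m] x(2) by blast
      ultimately show ?thesis
        using n by blast
    qed
    then show "\<exists>k. \<forall>x\<in>topspace X. y \<in> W k x \<longrightarrow> W k x \<subseteq> p"
      by blast
  qed
  then show ?thesis
    by blast
qed

theorem completely_metrizable:
  assumes "countable_filter P (\<subseteq>) \<Theta>" "t0_space X" "complete_family X P \<Theta>"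
  shows "completely_metrizable_space X"
proof -
  obtain B W where "ball_system X P \<Theta> B W"
    using ex_ball_system[OF assms(1)] by blast
  then show ?thesis
    using assms(2,3) by (rule ball_system.metrizable_by_balls)
qed

end

section \<open>The filter on the spectrum\<close>

context admissible_filter
begin

abbreviation \<Theta>Y where
  "\<Theta>Y \<equiv> (\<lambda>C. U ` C) ` \<Theta>"

lemma in_U_iff: "R \<in> U p \<longleftrightarrow> R \<in> spectrum P le regular \<and> p \<in> R"
  unfolding spectrum_open_def by blast

lemma members_at_image:
  assumes "R \<in> spectrum P le regular"
  shows "members_at (U ` C) R = U ` (C \<inter> R)"
  unfolding members_at_def using assms in_U_iff by blast

lemma image_covers: "\<Theta>Y \<subseteq> covers_of Y (U ` P)"
proof
  fix D assume "D \<in> \<Theta>Y"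
  then obtain C where C: "C \<in> \<Theta>" "D = U ` C"
    by blast
  have "R \<in> \<Union>D" if R: "R \<in> topspace Y" for R
  proof -
    have "R \<in> spectrum P le regular"
      using R by simp
    moreover from this obtain c where "c \<in> C" "c \<in> R"
      using spectrum_in(2) C(1) unfolding set_cauchy_def by blast
    ultimately show ?thesis
      using C(2) in_U_iff by blast
  qed
  then show "D \<in> covers_of Y (U ` P)"
    unfolding covers_of_def using C member_subset by blast
qed

lemma image_compatible: "compatible_family Y \<Theta>Y"
  unfolding compatible_family_def
proof (intro ballI conjI allI impI)
  fix R D assume "R \<in> topspace Y" and D: "D \<in> \<Theta>Y"
  then have R: "R \<in> spectrum P le regular"
    by simp
  obtain C where C: "C \<in> \<Theta>" "D = U ` C"
    using D by blast
  obtain c where c: "c \<in> C" "c \<in> R"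
    using spectrum_in(2)[OF R] C(1) unfolding set_cauchy_def by blast
  have op: "openin Y (\<Union>(members_at D R))"
    unfolding members_at_def
    by (rule openin_Union) (use C openin_U member_subset in blast)
  have "R \<in> \<Union>(members_at D R)"
    using c C(2) R in_U_iff unfolding members_at_def by blast
  then show "nbhd_of Y R (\<Union>(members_at D R))"
    unfolding nbhd_of_def using op openin_subset[OF op] by blast
next
  fix R N assume "R \<in> topspace Y" and N: "nbhd_of Y R N"
  then have R: "R \<in> spectrum P le regular"
    by simp
  obtain S where S: "openin Y S" "R \<in> S" "S \<subseteq> N"
    using N unfolding nbhd_of_def by blast
  obtain b where b: "b \<in> U ` P" "R \<in> b" "b \<subseteq> S"
    by (rule is_basis_ofE[OF spectrum_basis S(1,2)])
  then obtain p where p: "p \<in> P" "b = U p"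
    by blast
  then have pN: "U p \<subseteq> N"
    using b(3) S(3) by blast
  have "p \<in> R"
    using b(2) p(2) in_U_iff by simp
  then obtain C where C: "C \<in> \<Theta>" "\<And>c. c \<in> C \<Longrightarrow> c \<in> R \<Longrightarrow> le c p"
    using filter_round[OF spectrum_in(3,1)[OF R]] by metis
  have "U c \<subseteq> N" if "c \<in> C \<inter> R" for c
  proof -
    have "U c \<subseteq> U p"
      using U_mono[OF _ p(1) C(2)] that member_subset[OF C(1)] by blast
    then show ?thesis
      using pN by (rule subset_trans)
  qed
  then have "\<Union>(members_at (U ` C) R) \<subseteq> N"
    unfolding members_at_image[OF R] by blast
  then show "\<exists>C\<in>\<Theta>Y. \<Union>(members_at C R) \<subseteq> N"
    using C(1) by blast
qed

text \<open>Given \<open>c \<in> C \<inter> R\<close>, take \<open>s \<in> R\<close> with \<open>s \<lhd> c\<close>, and let \<open>D\<close> refine both a witness of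
  this and a family whose members in \<open>R\<close> are below \<open>s\<close>.  A member of \<open>D\<close> that meets the star of
  \<open>R\<close> then touches \<open>s\<close>, hence is below \<open>c\<close>.\<close>

lemma image_locally_uniform: "locally_uniform Y \<Theta>Y"
  unfolding locally_uniform_def
proof (intro ballI)
  fix R C' assume "R \<in> topspace Y" and C': "C' \<in> \<Theta>Y"
  then have R: "R \<in> spectrum P le regular"
    by simp
  obtain C where C: "C \<in> \<Theta>" "C' = U ` C"
    using C' by blast
  obtain c where c: "c \<in> C" "c \<in> R"
    using spectrum_in(2)[OF R] C(1) unfolding set_cauchy_def by blast
  obtain s where s: "s \<in> R" "s \<lhd> c"
    using filter_lower_bound[OF spectrum_in(3)[OF R], of "{c}"] c by auto
  then obtain E where E: "E \<in> \<Theta>" "\<forall>e\<in>E. touches e s \<longrightarrow> le e c"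
    unfolding below_iff by blast
  obtain F where F: "F \<in> \<Theta>" "\<And>f. f \<in> F \<Longrightarrow> f \<in> R \<Longrightarrow> le f s"
    using filter_round[OF spectrum_in(3,1)[OF R] s(1)] by metis
  obtain D where D: "D \<in> \<Theta>" "refines le D E" "refines le D F"
    using common_refinement[OF E(1) F(1)] by metis
  have sP: "s \<in> P" "c \<in> P"
    using below_in[OF s(2)] by blast+
  have star: "U d \<subseteq> U s" if d: "d \<in> D" "d \<in> R" for d
  proof -
    obtain f where f: "f \<in> F" "le d f"
      using D(3) d unfolding refines_def by blast
    have P: "d \<in> P" "f \<in> P"
      using d f member_subset D(1) F(1) by blast+
    have "f \<in> R"
      using up_setD[OF spectrum_in(4)[OF R] d(2) P(2) f(2)] .
    then have "le d s"
      using le_trans[OF f(2) F(2)[OF f(1)]] P sP by blast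
    then show ?thesis
      using U_mono P sP by blast
  qed
  have meet: "U d \<subseteq> U c" if d: "d \<in> D" and meet: "U d \<inter> U s \<noteq> {}" for d
  proof -
    obtain S where S: "S \<in> spectrum P le regular" "d \<in> S" "s \<in> S"
      using meet in_U_iff by blast
    obtain t where t: "t \<in> S" "le t d" "le t s"
      using spectrum_lower_bound[OF S] .
    have P: "d \<in> P"
      using d member_subset D(1) by blast
    have "touches d s"
      using touches_common_lower_bound[OF spectrum_near[OF S(1) t(1)] t(2,3) P sP(1)] .
    then have "le d c"
      using star_bound_refine[OF E(2) D(2) member_subset[OF D(1)] member_subset[OF E(1)] sP(2) d]
      by blast
    then show ?thesis
      using U_mono P sP by blast
  qed
  have "b \<subseteq> U c" if b: "b \<in> members_meeting (U ` D) (\<Union>(members_at (U ` D) R))" for b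
  proof -
    obtain d d' where "b = U d" "d \<in> D" "d' \<in> D" "d' \<in> R" "U d \<inter> U d' \<noteq> {}"
      using b unfolding members_meeting_def members_at_image[OF R] by blast
    then show ?thesis
      using meet[of d] star[of d'] by blast
  qed
  moreover have "U c \<in> members_at C' R"
    unfolding C(2) members_at_image[OF R] using c by blast
  ultimately have "\<Union>(members_meeting (U ` D) (\<Union>(members_at (U ` D) R))) \<subseteq> \<Union>(members_at C' R)"
    by (meson Sup_least Union_upper subset_trans)
  then show "\<exists>D\<in>\<Theta>Y. \<Union>(members_meeting D (\<Union>(members_at D R))) \<subseteq> \<Union>(members_at C' R)"
    using D(1) by blast
qed

text \<open>A Cauchy \<open>\<lhd>\<close>-filter of near elements is a point of the spectrum, and it contains its
  own neighbourhoods.  Any other one contains an element that is not near.  Such an element is the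
  least one, so the filter is the whole poset and every point of the spectrum will do.  A point
  exists unless the poset consists of the least element alone; but this element would then be near,
  as no member of \<open>\<Theta>\<close> is empty.\<close>

lemma image_complete:
  assumes cf: "countable_filter P le \<Theta>"
  shows "complete_family Y (U ` P) \<Theta>Y"
proof -
  interpret order_representation P le \<Theta> U
    by unfold_locales (rule le_iff_U_subset[OF cf])
  show ?thesis
    unfolding complete_family_def
  proof (intro allI impI)
    fix R' assume R'P: "R' \<subseteq> U ` P"
      and R': "set_cauchy \<Theta>Y R' \<and> unif_below_filter (U ` P) (\<subseteq>) \<Theta>Y R'"
    define R where "R = {p \<in> P. U p \<in> R'}"
    have R'_eq: "R' = U ` R"
      using R'P unfolding R_def by blast
    have RP: "R \<subseteq> P"
      unfolding R_def by blast
    have cauchy: "set_cauchy \<Theta> R"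
      unfolding set_cauchy_def
    proof
      fix C assume C: "C \<in> \<Theta>"
      then have "U ` C \<inter> R' \<noteq> {}"
        using R' unfolding set_cauchy_def by blast
      then show "C \<inter> R \<noteq> {}"
        using member_subset[OF C] unfolding R_def by blast
    qed
    have filter: "unif_below_filter P le \<Theta> R"
      unfolding unif_below_filter_def
    proof (intro conjI ballI allI impI RP)
      fix r p assume r: "r \<in> R" "p \<in> P" "r \<lhd> p"
      then have "image.below (U r) (U p)"
        using below_image_iff RP by blast
      then have "U p \<in> R'"
        using image.filter_up[OF conjunct2[OF R']] r(1) unfolding R_def by blast
      then show "p \<in> R"
        using r(2) unfolding R_def by blast
    next
      fix F assume F: "finite F \<and> F \<subseteq> R"
      then have "finite (U ` F)" "U ` F \<subseteq> R'"
        unfolding R'_eq by blast+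
      then have "\<exists>s\<in>R'. \<forall>f\<in>U ` F. image.below s f"
        by (rule image.filter_lower_bound[OF conjunct2[OF R']])
      then obtain s where s: "s \<in> R" "\<forall>f\<in>F. image.below (U s) (U f)"
        unfolding R'_eq by blast
      then have "\<forall>f\<in>F. s \<lhd> f"
        using below_image_iff RP F by blast
      then show "\<exists>s\<in>R. \<forall>f\<in>F. s \<lhd> f"
        using s(1) by blast
    qed
    show "\<exists>x\<in>topspace Y. members_at (U ` P) x \<subseteq> R'"
    proof (cases "R \<subseteq> near_elements P le \<Theta>")
      case True
      then have R: "R \<in> spectrum P le regular"
        unfolding spectrum_eq using cauchy filter by simp
      have "members_at (U ` P) R \<subseteq> R'"
        unfolding members_at_image[OF R] R'_eq by blast
      then show ?thesis
        using R by auto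
    next
      case False
      then obtain r where r: "r \<in> R" "\<not> near P le \<Theta> {r}"
        using RP unfolding near_elements_def by blast
      have least: "r \<lhd> p" if "p \<in> P" for p
        using below_if_not_near[OF _ r(2) that] r(1) RP by blast
      have "R = P"
        using least filter_up[OF filter r(1)] RP by blast
      have "\<exists>p\<in>P. \<not> le p r"
      proof (rule ccontr)
        assume "\<not> (\<exists>p\<in>P. \<not> le p r)"
        then have "P = {r}"
          using r(1) RP le_antisym below_le[OF least] by blast
        obtain C where C: "C \<in> \<Theta>"
          using nonempty by blast
        have "{} \<notin> \<Theta>"
          using cauchy unfolding set_cauchy_def by blast
        moreover have "C \<subseteq> {r}"
          using member_subset[OF C] \<open>P = {r}\<close> by simp
        ultimately have "{r} \<in> \<Theta>"
          using C subset_singletonD by metis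
        then have "near P le \<Theta> {r}"
          unfolding near_iff using \<open>{} \<notin> \<Theta>\<close> \<open>P = {r}\<close> by blast
        with r(2) show False ..
      qed
      then obtain p where p: "p \<in> P" "\<not> le p r"
        by blast
      obtain S where "S \<in> spectrum P le regular"
        using spectrum_separates[OF cf p(1) _ p(2)] r(1) RP by blast
      moreover have "members_at (U ` P) S \<subseteq> R'" for S
        unfolding R'_eq \<open>R = P\<close> members_at_def by blast
      ultimately show ?thesis
        by auto
    qed
  qed
qed

lemma image_uniform_cover_filter:
  assumes cf: "countable_filter P le \<Theta>"
  shows "uniform_cover_filter Y (U ` P) \<Theta>Y"
proof -
  interpret order_representation P le \<Theta> U
    by unfold_locales (rule le_iff_U_subset[OF cf])
  show ?thesis
    by unfold_locales
      (rule spectrum_basis image_covers filter_image image_locally_uniform image_compatible)+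
qed

end

section \<open>The duality\<close>

theorem abstract_to_concrete:
  fixes P :: "'a set" and le \<Theta>
  defines "Y \<equiv> spectrum_topology P le (regularisation P le \<Theta>)"
    and "U \<equiv> spectrum_open P le (regularisation P le \<Theta>)"
  defines "\<Theta>' \<equiv> (\<lambda>C. U ` C) ` \<Theta>"
  assumes "poset P le" and cf: "countable_filter P le \<Theta>" and "admissible P le \<Theta>"
  shows "completely_metrizable_space Y" "is_basis_of Y (U ` P)"
    "\<forall>p\<in>P. \<forall>q\<in>P. le p q \<longleftrightarrow> U p \<subseteq> U q" "\<Theta>' \<subseteq> covers_of Y (U ` P)"
    "countable_filter (U ` P) (\<subseteq>) \<Theta>'" "complete_family Y (U ` P) \<Theta>'"
    "locally_uniform Y \<Theta>'" "compatible_family Y \<Theta>'"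
proof -
  have "refinement_filter P le \<Theta>"
    using cf by (simp add: countable_filter_def)
  then interpret A: admissible_filter P le \<Theta>
    using assms by unfold_locales
  interpret O: order_representation P le \<Theta> A.U
    by unfold_locales (rule A.le_iff_U_subset[OF cf])
  interpret C: uniform_cover_filter A.Y "A.U ` P" A.\<Theta>Y
    by (rule A.image_uniform_cover_filter[OF cf])
  show "completely_metrizable_space Y"
    unfolding Y_def
    by (rule C.completely_metrizable[OF O.countable_filter_image[OF cf] A.spectrum_t0
          A.image_complete[OF cf]])
  show "\<forall>p\<in>P. \<forall>q\<in>P. le p q \<longleftrightarrow> U p \<subseteq> U q"
    unfolding U_def using A.le_iff_U_subset[OF cf] by blast
  show "is_basis_of Y (U ` P)" "\<Theta>' \<subseteq> covers_of Y (U ` P)" "countable_filter (U ` P) (\<subseteq>) \<Theta>'"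
    "complete_family Y (U ` P) \<Theta>'" "locally_uniform Y \<Theta>'" "compatible_family Y \<Theta>'"
    unfolding Y_def U_def \<Theta>'_def
    by (rule A.spectrum_basis A.image_covers O.countable_filter_image[OF cf]
        A.image_complete[OF cf] A.image_locally_uniform A.image_compatible)+
qed

theorem concrete_to_abstract:
  assumes "completely_metrizable_space X" "is_basis_of X P" "\<Theta> \<subseteq> covers_of X P"
    "countable_filter P (\<subseteq>) \<Theta>" and complete: "complete_family X P \<Theta>"
    and "locally_uniform X \<Theta>" "compatible_family X \<Theta>"
  shows "admissible P (\<subseteq>) \<Theta>"
    "spectrum P (\<subseteq>) (regularisation P (\<subseteq>) \<Theta>) =
      {R. R \<subseteq> near_elements P (\<subseteq>) \<Theta> \<and> set_cauchy \<Theta> R \<and> unif_below_filter P (\<subseteq>) \<Theta> R}"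
    "{R. R \<subseteq> near_elements P (\<subseteq>) \<Theta> \<and> set_cauchy \<Theta> R \<and> unif_below_filter P (\<subseteq>) \<Theta> R} =
      {members_at P x | x. x \<in> topspace X}"
    "spectrum_topology P (\<subseteq>) (regularisation P (\<subseteq>) \<Theta>) homeomorphic_space X"
proof -
  have "refinement_filter P (\<subseteq>) \<Theta>"
    using assms(4) by (simp add: countable_filter_def)
  then interpret uniform_cover_filter X P \<Theta>
    using assms by unfold_locales
  have "Hausdorff_space X"
    using assms(1) completely_metrizable_imp_metrizable_space metrizable_imp_Hausdorff_space by blast
  then have t0: "t0_space X"
    by (simp add: Hausdorff_imp_t1_space t1_imp_t0_space)
  show "admissible P (\<subseteq>) \<Theta>"
    by (rule admissible)
  show "spectrum P (\<subseteq>) (regularisation P (\<subseteq>) \<Theta>) =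
      {R. R \<subseteq> near_elements P (\<subseteq>) \<Theta> \<and> set_cauchy \<Theta> R \<and> unif_below_filter P (\<subseteq>) \<Theta> R}"
    by (rule spectrum_eq)
  show "{R. R \<subseteq> near_elements P (\<subseteq>) \<Theta> \<and> set_cauchy \<Theta> R \<and> unif_below_filter P (\<subseteq>) \<Theta> R} =
      {members_at P x | x. x \<in> topspace X}"
    by (rule cauchy_filters_eq_points[OF complete])
  show "spectrum_topology P (\<subseteq>) (regularisation P (\<subseteq>) \<Theta>) homeomorphic_space X"
    by (rule spectrum_homeomorphic[OF t0 complete])
qed

theorem theorem11p6:
  shows
    "(\<forall>(P :: 'a set) (le :: 'a \<Rightarrow> 'a \<Rightarrow> bool) (\<Theta> :: 'a set set).
        poset P le \<and> countable_filter P le \<Theta> \<and> admissible P le \<Theta> \<longrightarrow>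
        (let Y = spectrum_topology P le (regularisation P le \<Theta>);
             U = spectrum_open P le (regularisation P le \<Theta>);
             \<Theta>' = (\<lambda>C. U ` C) ` \<Theta>
         in completely_metrizable_space Y \<and>
            is_basis_of Y (U ` P) \<and>
            (\<forall>p\<in>P. \<forall>q\<in>P. le p q \<longleftrightarrow> U p \<subseteq> U q) \<and>
            \<Theta>' \<subseteq> covers_of Y (U ` P) \<and>
            countable_filter (U ` P) (\<subseteq>) \<Theta>' \<and>
            (countable \<Theta> \<longrightarrow> countable \<Theta>') \<and>
            complete_family Y (U ` P) \<Theta>' \<and>
            locally_uniform Y \<Theta>' \<and>
            compatible_family Y \<Theta>'))
     \<and>
     (\<forall>(X :: 'b topology) (P :: 'b set set) (\<Theta> :: 'b set set set).
        completely_metrizable_space X \<and> is_basis_of X P \<and>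
        \<Theta> \<subseteq> covers_of X P \<and> countable_filter P (\<subseteq>) \<Theta> \<and>
        complete_family X P \<Theta> \<and> locally_uniform X \<Theta> \<and> compatible_family X \<Theta> \<longrightarrow>
        admissible P (\<subseteq>) \<Theta> \<and>
        spectrum P (\<subseteq>) (regularisation P (\<subseteq>) \<Theta>) =
          {R. R \<subseteq> near_elements P (\<subseteq>) \<Theta> \<and> set_cauchy \<Theta> R \<and> unif_below_filter P (\<subseteq>) \<Theta> R} \<and>
        {R. R \<subseteq> near_elements P (\<subseteq>) \<Theta> \<and> set_cauchy \<Theta> R \<and> unif_below_filter P (\<subseteq>) \<Theta> R} =
          {members_at P x | x. x \<in> topspace X} \<and>
        spectrum_topology P (\<subseteq>) (regularisation P (\<subseteq>) \<Theta>) homeomorphic_space X)"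
proof (intro conjI allI impI)
  fix P :: "'a set" and le \<Theta>
  assume A: "poset P le \<and> countable_filter P le \<Theta> \<and> admissible P le \<Theta>"
  note dual = abstract_to_concrete[of P le \<Theta>, OF A[THEN conjunct1]
      A[THEN conjunct2, THEN conjunct1] A[THEN conjunct2, THEN conjunct2]]
  show "let Y = spectrum_topology P le (regularisation P le \<Theta>);
             U = spectrum_open P le (regularisation P le \<Theta>);
             \<Theta>' = (\<lambda>C. U ` C) ` \<Theta>
         in completely_metrizable_space Y \<and>
            is_basis_of Y (U ` P) \<and>
            (\<forall>p\<in>P. \<forall>q\<in>P. le p q \<longleftrightarrow> U p \<subseteq> U q) \<and>
            \<Theta>' \<subseteq> covers_of Y (U ` P) \<and>
            countable_filter (U ` P) (\<subseteq>) \<Theta>' \<and>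
            (countable \<Theta> \<longrightarrow> countable \<Theta>') \<and>
            complete_family Y (U ` P) \<Theta>' \<and>
            locally_uniform Y \<Theta>' \<and>
            compatible_family Y \<Theta>'"
    unfolding Let_def by (intro conjI dual impI countable_image)
next
  fix X :: "'b topology" and P :: "'b set set" and \<Theta> :: "'b set set set"
  assume A: "completely_metrizable_space X \<and> is_basis_of X P \<and>
        \<Theta> \<subseteq> covers_of X P \<and> countable_filter P (\<subseteq>) \<Theta> \<and>
        complete_family X P \<Theta> \<and> locally_uniform X \<Theta> \<and> compatible_family X \<Theta>"
  then have "completely_metrizable_space X" "is_basis_of X P" "\<Theta> \<subseteq> covers_of X P"
    "countable_filter P (\<subseteq>) \<Theta>" "complete_family X P \<Theta>" "locally_uniform X \<Theta>"
    "compatible_family X \<Theta>"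
    by simp_all
  note dual = concrete_to_abstract[OF this]
  show "admissible P (\<subseteq>) \<Theta>"
    by (rule dual(1))
  show "spectrum P (\<subseteq>) (regularisation P (\<subseteq>) \<Theta>) =
          {R. R \<subseteq> near_elements P (\<subseteq>) \<Theta> \<and> set_cauchy \<Theta> R \<and> unif_below_filter P (\<subseteq>) \<Theta> R}"
    by (rule dual(2))
  show "{R. R \<subseteq> near_elements P (\<subseteq>) \<Theta> \<and> set_cauchy \<Theta> R \<and> unif_below_filter P (\<subseteq>) \<Theta> R} =
          {members_at P x | x. x \<in> topspace X}"
    by (rule dual(3))
  show "spectrum_topology P (\<subseteq>) (regularisation P (\<subseteq>) \<Theta>) homeomorphic_space X"
    by (rule dual(4))
qed

end
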